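(* Let $X\subset\mathbb{R}^d$ be a finite set and let $v,w\in S^{d-1}$ lie in the same connected component of $\Sigma(X)$. For a finite geometric simplicial complex $K\subset\mathbb{R}^d$ with (known) vertex set $X$, the Euler curve $\operatorname{ECT}(K)(w)$ can be deduced from the Euler curve $\operatorname{ECT}(K)(v)$; that is, $\operatorname{ECT}(K)(w)$ is a function of $X,v,w$ and $\operatorname{ECT}(K)(v)$ only. Similarly, for each $k\ge 0$, the $k$-th persistence diagram $PH_k(K,h_w)$ associated to filtering $K$ by $h_w$ can be deduced from (is a function of $X,v,w$ and) the $k$-th persistence diagram $PH_k(K,h_v)$ associated to filtering by $h_v$.
   Context: A finite geometric simplicial complex $K$ in $\mathbb{R}^d$ is a finite set of geometric simplices (convex hulls of affinely independent points) closed under taking faces and such that any two simplices intersect in the empty set or a common face; $K$ also denotes the union of its simplices. $\Sigma(X)=S^{d-1}\setminus W(X)$, where $W(X)=\bigcup_{x\ne y\in X}\{u\in\mathbb{R}^d: x\cdot u=y\cdot u\}$. $h_v(y)=v\cdot y$ for $y\in K$. $\operatorname{ECT}(K)(v)$ is the Euler curve $t\mapsto\chi(K_{v,t})$ with $K_{v,t}=\{y\in K: y\cdot v\le t\}$. Homology is with coefficients in a fixed field. $PH_k(K,h_v)$ is the unique finite multiset of off-diagonal points $(b,e)$, $b\in\{-\infty\}\cup\mathbb{R}$, $e\in\mathbb{R}\cup\{\infty\}$, $b<e$, such that for all $s\le t$ the rank of the inclusion-induced map $H_k(K_{v,s})\to H_k(K_{v,t})$ equals the number of points (with multiplicity) in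 $[-\infty,s]\times(t,\infty]$. Concretely, "$A(K)$ is a function of $X,v,w$ and $B(K)$" means: for all $K,K'$ with vertex set $X$, $B(K)=B(K')$ implies $A(K)=A(K')$. *)

theory Defs
  imports "HOL-Analysis.Analysis" "HOL-Homology.Homology" "HOL-Library.Multiset"
begin

section \<open>Singular homology with coefficients in a field\<close>

text \<open>
  HOL-Homology provides singular homology over the integers only. The chains, the boundary and
  the homology below follow its \<open>singular_chain\<close>, \<open>chain_boundary\<close> and
  \<open>homology_group\<close>, with the integers replaced by a field \<open>'f\<close>.
\<close>

type_synonym ('a, 'f) fchain = "((nat \<Rightarrow> real) \<Rightarrow> 'a) \<Rightarrow>\<^sub>0 'f"

definition fchains :: "nat \<Rightarrow> 'a topology \<Rightarrow> ('a, 'f::field) fchain set" where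
  "fchains p X = {c. Poly_Mapping.keys c \<subseteq> singular_simplex_set p X}"

definition fchain_scale :: "'f::field \<Rightarrow> ('a, 'f) fchain \<Rightarrow> ('a, 'f) fchain" where
  "fchain_scale a c = Poly_Mapping.map ((*) a) c"

definition fchain_boundary :: "nat \<Rightarrow> ('a, 'f::field) fchain \<Rightarrow> ('a, 'f) fchain" where
  "fchain_boundary p c =
     (if p = 0 then 0 else
      \<Sum>\<sigma>\<in>Poly_Mapping.keys c. \<Sum>k\<le>p.
        Poly_Mapping.single (singular_face p k \<sigma>) ((-1) ^ k * Poly_Mapping.lookup c \<sigma>))"

definition fcycles :: "nat \<Rightarrow> 'a topology \<Rightarrow> ('a, 'f::field) fchain set" where
  "fcycles p X = {c \<in> fchains p X. fchain_boundary p c = 0}"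

definition fboundaries :: "nat \<Rightarrow> 'a topology \<Rightarrow> ('a, 'f::field) fchain set" where
  "fboundaries p X = fchain_boundary (Suc p) ` fchains (Suc p) X"

definition homology_class ::
    "nat \<Rightarrow> 'a topology \<Rightarrow> ('a, 'f::field) fchain \<Rightarrow> ('a, 'f) fchain set" where
  "homology_class p X c = {c + b | b. b \<in> fboundaries p X}"

text \<open>
  The vector space of cycles modulo boundaries; its elements are cosets. The HOL-Algebra record
  \<open>module\<close> extends \<open>ring\<close>, so it has the fields \<open>mult\<close> and \<open>one\<close>, which play no role
  for a module.
\<close>

definition homology :: "nat \<Rightarrow> 'a topology \<Rightarrow> ('f::field, ('a, 'f) fchain set) module" where
  "homology p X =
     \<lparr> carrier = homology_class p X ` fcycles p X,
       mult = undefined,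
       one = undefined,
       zero = fboundaries p X,
       add = (\<lambda>C D. {c + d | c d. c \<in> C \<and> d \<in> D}),
       smult = (\<lambda>a C. {fchain_scale a c + b | c b. c \<in> C \<and> b \<in> fboundaries p X}) \<rparr>"

text \<open>
  The map into the homology of \<open>Y\<close> induced by the inclusion of a subspace \<open>X\<close> of \<open>Y\<close>. On
  chains an inclusion is the identity, so \<open>c\<close> plus the boundaries of \<open>X\<close> is sent to \<open>c\<close> plus
  the boundaries of \<open>Y\<close>.
\<close>

definition homology_inclusion ::
    "nat \<Rightarrow> 'a topology \<Rightarrow> ('a, 'f::field) fchain set \<Rightarrow> ('a, 'f) fchain set" where
  "homology_inclusion p Y C = (\<Union>c\<in>C. homology_class p Y c)"

section \<open>Dimension and rank\<close>

definition module_lincomb :: "('f, 'v) module \<Rightarrow> ('v \<Rightarrow> 'f) \<Rightarrow> 'v set \<Rightarrow> 'v" where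
  "module_lincomb M a S = finsum M (\<lambda>x. a x \<odot>\<^bsub>M\<^esub> x) S"

definition module_finite_basis :: "('f::field, 'v) module \<Rightarrow> 'v set \<Rightarrow> 'v set \<Rightarrow> bool" where
  "module_finite_basis M U S \<longleftrightarrow>
     finite S \<and> S \<subseteq> U \<and>
     (\<forall>a. module_lincomb M a S = \<zero>\<^bsub>M\<^esub> \<longrightarrow> (\<forall>x\<in>S. a x = 0)) \<and>
     U \<subseteq> range (\<lambda>a. module_lincomb M a S)"

text \<open>
  The dimension of a linear subspace \<open>U\<close> of \<open>M\<close>. As for the library's \<open>dim\<close>, infinite
  dimension is represented by \<open>0\<close>; the homology of a compact polyhedron is finite-dimensional.
\<close>

definition module_dim :: "('f::field, 'v) module \<Rightarrow> 'v set \<Rightarrow> nat" where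
  "module_dim M U =
     (if \<exists>S. module_finite_basis M U S then card (SOME S. module_finite_basis M U S) else 0)"

text \<open>
  The argument of type \<open>'f itself\<close> in the following definitions fixes the field of coefficients.
\<close>

definition inclusion_rank ::
    "'f::field itself \<Rightarrow> nat \<Rightarrow> 'a::topological_space set \<Rightarrow> 'a set \<Rightarrow> nat" where
  "inclusion_rank F p A B =
     module_dim (homology p (top_of_set B) :: ('f, ('a, 'f) fchain set) module)
       (homology_inclusion p (top_of_set B) `
          carrier (homology p (top_of_set A) :: ('f, ('a, 'f) fchain set) module))"

definition betti :: "'f::field itself \<Rightarrow> nat \<Rightarrow> 'a::topological_space set \<Rightarrow> nat" where
  "betti F p A =
     module_dim (homology p (top_of_set A) :: ('f, ('a, 'f) fchain set) module)
       (carrier (homology p (top_of_set A) :: ('f, ('a, 'f) fchain set) module))"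

definition euler_characteristic :: "'f::field itself \<Rightarrow> 'a::topological_space set \<Rightarrow> int" where
  "euler_characteristic F A = (\<Sum>p | betti F p A \<noteq> 0. (-1) ^ p * int (betti F p A))"

section \<open>Geometric simplicial complexes, Euler curves and persistence diagrams\<close>

text \<open>
  The library's \<open>simplicial_complex\<close> counts the empty set as a \<open>(-1)\<close>-simplex and as a face
  of every simplex. This affects neither the union of the simplices nor the vertex set.
\<close>

definition vertex_set :: "'a::euclidean_space set set \<Rightarrow> 'a set" where
  "vertex_set K = {x. {x} \<in> K}"

definition sublevel :: "'a::euclidean_space set set \<Rightarrow> 'a \<Rightarrow> real \<Rightarrow> 'a set" where
  "sublevel K v t = {y \<in> \<Union>K. y \<bullet> v \<le> t}"

definition ECT :: "'f::field itself \<Rightarrow> 'a::euclidean_space set set \<Rightarrow> 'a \<Rightarrow> real \<Rightarrow> int" where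
  "ECT F K v = (\<lambda>t. euler_characteristic F (sublevel K v t))"

text \<open>
  For extended reals, \<open>b < e\<close> already excludes \<open>b = \<infinity>\<close> and \<open>e = -\<infinity>\<close>.
\<close>

definition is_persistence_diagram ::
    "'f::field itself \<Rightarrow> nat \<Rightarrow> 'a::euclidean_space set set \<Rightarrow> 'a \<Rightarrow>
     (ereal \<times> ereal) multiset \<Rightarrow> bool" where
  "is_persistence_diagram F k K v D \<longleftrightarrow>
     (\<forall>(b, e)\<in>#D. b < e) \<and>
     (\<forall>s t. s \<le> t \<longrightarrow>
        inclusion_rank F k (sublevel K v s) (sublevel K v t) =
        size {#(b, e) \<in># D. b \<in> {-\<infinity>..ereal s} \<and> e \<in> {ereal t<..\<infinity>}#})"

text \<open>
  \<open>PH F k K v\<close> is the persistence diagram of \<open>K\<close> filtered by the height function in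
  direction \<open>v\<close>. The value \<open>None\<close> would stand for the absence of a unique diagram, which does
  not occur for finite simplicial complexes.
\<close>

definition PH ::
    "'f::field itself \<Rightarrow> nat \<Rightarrow> 'a::euclidean_space set set \<Rightarrow> 'a \<Rightarrow>
     (ereal \<times> ereal) multiset option" where
  "PH F k K v =
     (if \<exists>!D. is_persistence_diagram F k K v D
      then Some (THE D. is_persistence_diagram F k K v D) else None)"

definition W_set :: "'a::euclidean_space set \<Rightarrow> 'a set" where
  "W_set X = (\<Union>x\<in>X. \<Union>y\<in>X - {x}. {u. x \<bullet> u = y \<bullet> u})"

definition Sigma_set :: "'a::euclidean_space set \<Rightarrow> 'a set" where
  "Sigma_set X = sphere 0 1 - W_set X"

end

theory Submission
  imports Defs
begin

text \<open>
  On a connected component of \<open>Sigma_set X\<close> the order of the heights of the vertices is constant, so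
  there is an increasing homeomorphism \<open>\<phi>\<close> of the real line with \<open>\<phi> (x \<bullet> v) = x \<bullet> w\<close> for all
  vertices \<open>x\<close>. It can be realised by a homeomorphism of the polyhedron: a rescaling of the
  barycentric coordinates, with weights depending on the height, carries each sublevel set
  \<open>sublevel K v t\<close> onto \<open>sublevel K w (\<phi> t)\<close>. Since one homeomorphism does this for all \<open>t\<close> at once,
  topological invariance of homology (rather than homotopy invariance) shows that \<open>\<phi>\<close> transports
  Betti numbers, ranks and hence Euler curves and persistence diagrams. In particular diagrams in
  direction \<open>v\<close> correspond bijectively to diagrams in direction \<open>w\<close>, so that their existence and
  uniqueness need not be known.
\<close>

section \<open>Bases modulo a subspace\<close>

text \<open>Representatives of a basis of the image of \<open>Z\<close> in the quotient by
  \<open>B\<close>, kept inside the ambient space. \<open>Z\<close> and \<open>B\<close> may come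
  from different spaces: for the rank of an inclusion, \<open>Z\<close> holds the cycles of the
  smaller space and \<open>B\<close> the boundaries of the larger one.\<close>

definition quotient_basis ::
    "('f::field \<Rightarrow> 'b::ab_group_add \<Rightarrow> 'b) \<Rightarrow> 'b set \<Rightarrow> 'b set \<Rightarrow> 'b set \<Rightarrow> bool" where
  "quotient_basis smul Z B T \<longleftrightarrow>
     finite T \<and> T \<subseteq> Z \<and>
     (\<forall>a. (\<Sum>x\<in>T. smul (a x) x) \<in> B \<longrightarrow> (\<forall>x\<in>T. a x = 0)) \<and>
     (\<forall>z\<in>Z. \<exists>a. z - (\<Sum>x\<in>T. smul (a x) x) \<in> B)"

text \<open>Otherwise the coefficients 1 at \<open>x\<close> and -1 at \<open>y\<close> would give a
  nontrivial relation modulo \<open>B\<close>. This makes passing from representatives to classes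
  injective.\<close>

lemma quotient_basis_distinct:
  fixes smul :: "'f::field \<Rightarrow> 'b::ab_group_add \<Rightarrow> 'b"
  assumes "vector_space smul"
    and T: "quotient_basis smul Z B T" and xy: "x \<in> T" "y \<in> T" "x - y \<in> B"
  shows "x = y"
proof (rule ccontr)
  interpret vector_space smul by fact
  assume ne: "x \<noteq> y"
  define a :: "'b \<Rightarrow> 'f" where "a z = (if z = x then 1 else if z = y then -1 else 0)" for z
  have "finite T" using T by (simp add: quotient_basis_def)
  have "(\<Sum>z\<in>T. smul (a z) z) = (\<Sum>z\<in>T. (if z = x then x else 0) - (if z = y then y else 0))"
    using ne by (intro sum.cong) (auto simp: a_def)
  also have "\<dots> = x - y"
    using xy \<open>finite T\<close> by (simp add: sum_subtractf)
  finally have "(\<Sum>z\<in>T. smul (a z) z) \<in> B" using xy by simp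
  then have "a x = 0" using T xy by (auto simp: quotient_basis_def)
  then show False by (simp add: a_def)
qed

text \<open>Replacing each \<open>t \<in> T\<close> by a combination of \<open>T'\<close> congruent to it modulo \<open>B\<close> gives an
  independent family in the span of \<open>T'\<close>.\<close>

lemma card_quotient_basis_le:
  fixes smul :: "'f::field \<Rightarrow> 'b::ab_group_add \<Rightarrow> 'b"
  assumes "vector_space smul" and B: "module.subspace smul B"
    and T: "quotient_basis smul Z B T" and T': "quotient_basis smul Z B T'"
  shows "card T \<le> card T'"
proof -
  interpret vector_space smul by fact
  have fin: "finite T" "finite T'" using T T' by (auto simp: quotient_basis_def)
  have "\<exists>a. t - (\<Sum>x\<in>T'. smul (a x) x) \<in> B" if "t \<in> T" for t
    using subsetD[OF _ that, of Z] T T' by (simp add: quotient_basis_def)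
  then obtain a where a: "\<And>t. t \<in> T \<Longrightarrow> t - (\<Sum>x\<in>T'. smul (a t x) x) \<in> B"
    by metis
  define \<alpha> where "\<alpha> t = (\<Sum>x\<in>T'. smul (a t x) x)" for t
  have \<alpha>: "t - \<alpha> t \<in> B" if "t \<in> T" for t using a[OF that] by (simp add: \<alpha>_def)
  have inj: "inj_on \<alpha> T"
  proof (rule inj_onI)
    fix s t assume st: "s \<in> T" "t \<in> T" "\<alpha> s = \<alpha> t"
    then have "(s - \<alpha> s) - (t - \<alpha> t) \<in> B" using \<alpha> B subspace_diff by blast
    then show "s = t" using st quotient_basis_distinct[OF assms(1) T] by simp
  qed
  have "independent (\<alpha> ` T)"
  proof -
    have "u v = 0" if s: "(\<Sum>v\<in>\<alpha> ` T. smul (u v) v) = 0" and v: "v \<in> \<alpha> ` T" for u v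
    proof -
      have "(\<Sum>t\<in>T. smul (u (\<alpha> t)) (\<alpha> t)) = 0"
        using s by (simp add: sum.reindex[OF inj] o_def)
      \<comment> \<open>Subtracting the vanishing combination of the \<open>\<alpha> t\<close>
        replaces each \<open>t\<close> by \<open>t - \<alpha> t\<close>, which lies in
        \<open>B\<close>; then independence of \<open>T\<close> modulo \<open>B\<close>
        applies.\<close>
      then have "(\<Sum>t\<in>T. smul (u (\<alpha> t)) t) = (\<Sum>t\<in>T. smul (u (\<alpha> t)) (t - \<alpha> t))"
        by (simp add: scale_right_diff_distrib sum_subtractf)
      also have "\<dots> \<in> B"
        by (intro subspace_sum[OF B] subspace_scale[OF B] \<alpha>)
      finally have "\<forall>t\<in>T. u (\<alpha> t) = 0"
        using T by (auto simp: quotient_basis_def dest: spec[of _ "\<lambda>t. u (\<alpha> t)"])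
      then show ?thesis using v by auto
    qed
    then show ?thesis using fin by (auto simp: dependent_finite)
  qed
  moreover have "\<alpha> ` T \<subseteq> span T'"
    unfolding \<alpha>_def by (rule image_subsetI, rule span_sum, rule span_scale, rule span_base)
  ultimately have "card (\<alpha> ` T) \<le> card T'"
    using independent_span_bound[OF fin(2)] by blast
  then show ?thesis by (simp add: card_image[OF inj])
qed

section \<open>Topological invariance of homology with field coefficients\<close>

lemma lookup_fchain_scale: "Poly_Mapping.lookup (fchain_scale a c) k = a * Poly_Mapping.lookup c k"
  by (simp add: fchain_scale_def Poly_Mapping.map.rep_eq when_def)

interpretation fchain: vector_space "fchain_scale :: 'f::field \<Rightarrow> ('a, 'f) fchain \<Rightarrow> _"
  by unfold_locales
    (auto intro!: poly_mapping_eqI simp: lookup_fchain_scale lookup_add algebra_simps)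

lemma keys_fchain_scale: "Poly_Mapping.keys (fchain_scale a c) \<subseteq> Poly_Mapping.keys c"
  by (auto simp: in_keys_iff lookup_fchain_scale)

lemma fchain_scale_single:
  "fchain_scale a (Poly_Mapping.single k b) = Poly_Mapping.single k (a * b)"
  by (rule poly_mapping_eqI) (simp add: lookup_fchain_scale lookup_single when_def)

text \<open>Linear extension from singular simplices, the basis of the chain space. The boundary and
  the induced chain map are both instances, so linearity is proved once.\<close>

definition fchain_extend ::
    "(((nat \<Rightarrow> real) \<Rightarrow> 'a) \<Rightarrow> ('b, 'f::field) fchain) \<Rightarrow> ('a, 'f) fchain \<Rightarrow> ('b, 'f) fchain" where
  "fchain_extend h c = (\<Sum>\<sigma>\<in>Poly_Mapping.keys c. fchain_scale (Poly_Mapping.lookup c \<sigma>) (h \<sigma>))"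

text \<open>Allows chains with different supports to be summed over a common index set, as
  additivity requires.\<close>

lemma fchain_extend_superset:
  assumes "finite S" "Poly_Mapping.keys c \<subseteq> S"
  shows "fchain_extend h c = (\<Sum>\<sigma>\<in>S. fchain_scale (Poly_Mapping.lookup c \<sigma>) (h \<sigma>))"
  unfolding fchain_extend_def
  by (rule sum.mono_neutral_left[OF assms]) (auto simp: in_keys_iff)

lemma linear_fchain_extend:
  fixes h :: "((nat \<Rightarrow> real) \<Rightarrow> 'a) \<Rightarrow> ('b, 'f::field) fchain"
  shows "Vector_Spaces.linear fchain_scale fchain_scale (fchain_extend h)"
proof (unfold_locales)
  fix c d :: "('a, 'f) fchain"
  let ?S = "Poly_Mapping.keys c \<union> Poly_Mapping.keys d"
  have S: "finite ?S" by simp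
  show "fchain_extend h (c + d) = fchain_extend h c + fchain_extend h d"
    by (simp add: fchain_extend_superset[OF S] keys_add lookup_add fchain.scale_left_distrib
        sum.distrib)
next
  fix a :: 'f and c :: "('a, 'f) fchain"
  have S: "finite (Poly_Mapping.keys c)" by simp
  show "fchain_extend h (fchain_scale a c) = fchain_scale a (fchain_extend h c)"
    by (simp add: fchain_extend_superset[OF S] keys_fchain_scale lookup_fchain_scale
        fchain.scale_sum_right)
qed

lemma fchain_extend_single [simp]:
  "fchain_extend h (Poly_Mapping.single \<sigma> a) = fchain_scale a (h \<sigma>)"
  by (simp add: fchain_extend_superset[of "{\<sigma>}"])

definition simplex_boundary :: "nat \<Rightarrow> ((nat \<Rightarrow> real) \<Rightarrow> 'a) \<Rightarrow> ('a, 'f::field) fchain" where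
  "simplex_boundary p \<sigma> =
     (if p = 0 then 0 else \<Sum>k\<le>p. Poly_Mapping.single (singular_face p k \<sigma>) ((-1) ^ k))"

lemma fchain_boundary_eq: "fchain_boundary p = fchain_extend (simplex_boundary p)"
  by (rule ext) (simp add: fchain_boundary_def fchain_extend_def simplex_boundary_def
      fchain.scale_sum_right fchain_scale_single mult.commute)

definition fchain_map ::
    "nat \<Rightarrow> ('a \<Rightarrow> 'b) \<Rightarrow> ('a, 'f::field) fchain \<Rightarrow> ('b, 'f) fchain" where
  "fchain_map p f = fchain_extend (\<lambda>\<sigma>. Poly_Mapping.single (simplex_map p f \<sigma>) 1)"

interpretation fchain_boundary:
  Vector_Spaces.linear fchain_scale fchain_scale "fchain_boundary p"
  unfolding fchain_boundary_eq by (rule linear_fchain_extend)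

interpretation fchain_map:
  Vector_Spaces.linear fchain_scale fchain_scale "fchain_map p f"
  unfolding fchain_map_def by (rule linear_fchain_extend)

lemma fchain_map_eq:
  "fchain_map p f c =
     (\<Sum>\<sigma>\<in>Poly_Mapping.keys c. Poly_Mapping.single (simplex_map p f \<sigma>) (Poly_Mapping.lookup c \<sigma>))"
  by (simp add: fchain_map_def fchain_extend_def fchain_scale_single)

lemma fchain_eq_sum_single:
  "c = (\<Sum>\<sigma>\<in>Poly_Mapping.keys c. Poly_Mapping.single \<sigma> (Poly_Mapping.lookup c \<sigma>))"
  by (rule poly_mapping_eqI) (auto simp: lookup_sum lookup_single when_def in_keys_iff)

text \<open>Faces arise by precomposition and \<open>simplex_map\<close> by postcomposition, so the
  two commute. For \<open>p = 0\<close> the truncated index \<open>p - Suc 0\<close> is harmless,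
  since both sides vanish.\<close>

lemma simplex_boundary_simplex_map:
  "simplex_boundary p (simplex_map p f \<sigma>) = fchain_map (p - Suc 0) f (simplex_boundary p \<sigma>)"
proof (cases "p = 0")
  case False
  have "singular_face p k (simplex_map p f \<sigma>) = simplex_map (p - Suc 0) f (singular_face p k \<sigma>)"
    if "k \<le> p" for k
    using that False by (auto simp: singular_face_def simplex_map_def fun_eq_iff simplical_face_in_standard_simplex)
  then show ?thesis
    using False
    by (simp add: simplex_boundary_def fchain_map.sum)
      (simp add: fchain_map_def fchain_scale_single)
qed (simp add: simplex_boundary_def)

lemma fchain_boundary_fchain_map:
  "fchain_boundary p (fchain_map p f c) = fchain_map (p - Suc 0) f (fchain_boundary p c)"
  by (simp add: fchain_map_eq[of p] fchain_boundary.sum)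
    (simp add: fchain_boundary_eq fchain_extend_def[of _ c] simplex_boundary_simplex_map
      fchain_map.sum fchain_map.scale)

lemma subspace_fchains: "fchain.subspace (fchains p X)"
  using keys_add keys_fchain_scale by (fastforce simp: fchain.subspace_def fchains_def)

lemma subspace_fcycles: "fchain.subspace (fcycles p X)"
  using subspace_fchains[of p X]
  by (auto simp: fchain.subspace_def fcycles_def fchain_boundary.add fchain_boundary.scale)

lemma subspace_fboundaries: "fchain.subspace (fboundaries p X)"
  unfolding fboundaries_def by (intro fchain_boundary.subspace_image subspace_fchains)

lemma fchain_map_in_fchains:
  assumes "continuous_map X Y f" "c \<in> fchains p X"
  shows "fchain_map p f c \<in> fchains p Y"
  unfolding fchain_map_eq
  using assms
  by (intro fchain.subspace_sum[OF subspace_fchains])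
    (auto simp: fchains_def intro: singular_simplex_simplex_map)

text \<open>A singular simplex of \<open>X\<close> takes its values in \<open>topspace X\<close>,
  where \<open>g \<circ> f\<close> is the identity, so every simplex in the support of
  \<open>c\<close> is restored.\<close>

lemma fchain_map_inverse:
  assumes f: "continuous_map X Y f" and gf: "\<And>x. x \<in> topspace X \<Longrightarrow> g (f x) = x"
    and c: "c \<in> fchains p X"
  shows "fchain_map p g (fchain_map p f c) = c"
proof -
  have "simplex_map p g (simplex_map p f \<sigma>) = \<sigma>" if "\<sigma> \<in> Poly_Mapping.keys c" for \<sigma>
  proof -
    have "singular_simplex p X \<sigma>" using that c by (auto simp: fchains_def)
    then have "simplex_map p (g \<circ> f) \<sigma> = \<sigma>" using gf by (intro simplex_map_id_gen) auto
    then show ?thesis by (simp add: simplex_map_compose)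
  qed
  then have "fchain_map p g (fchain_map p f c) =
      (\<Sum>\<sigma>\<in>Poly_Mapping.keys c. Poly_Mapping.single \<sigma> (Poly_Mapping.lookup c \<sigma>))"
    by (simp add: fchain_map_eq[of _ f] fchain_map.sum) (simp add: fchain_map_def fchain_scale_single)
  then show ?thesis using fchain_eq_sum_single[of c] by simp
qed

lemma fchain_map_in_fcycles:
  assumes "continuous_map X Y f" "c \<in> fcycles p X"
  shows "fchain_map p f c \<in> fcycles p Y"
  using assms fchain_map_in_fchains[OF assms(1)]
  by (auto simp: fcycles_def fchain_boundary_fchain_map)

lemma fchain_map_in_fboundaries:
  assumes f: "continuous_map X Y f" and c: "c \<in> fboundaries p X"
  shows "fchain_map p f c \<in> fboundaries p Y"
proof -
  obtain e where e: "e \<in> fchains (Suc p) X" "c = fchain_boundary (Suc p) e"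
    using c by (auto simp: fboundaries_def)
  then have "fchain_map p f c = fchain_boundary (Suc p) (fchain_map (Suc p) f e)"
    by (simp add: fchain_boundary_fchain_map)
  then show ?thesis using fchain_map_in_fchains[OF f e(1)] by (auto simp: fboundaries_def)
qed

section \<open>Homology classes and bases of homology\<close>

lemma homology_class_eq_iff:
  "homology_class p X c = homology_class p X d \<longleftrightarrow> c - d \<in> fboundaries p X"
proof
  assume "homology_class p X c = homology_class p X d"
  moreover have "c \<in> homology_class p X c"
    using fchain.subspace_0[OF subspace_fboundaries] by (force simp: homology_class_def)
  ultimately obtain b where "b \<in> fboundaries p X" "c = d + b"
    by (auto simp: homology_class_def)
  then show "c - d \<in> fboundaries p X" by simp
next
  have *: "homology_class p X c \<subseteq> homology_class p X d" if "c - d \<in> fboundaries p X" for c d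
  proof
    fix e assume "e \<in> homology_class p X c"
    then obtain b where b: "b \<in> fboundaries p X" "e = c + b" by (auto simp: homology_class_def)
    then have "e = d + ((c - d) + b)" by simp
    then show "e \<in> homology_class p X d"
      using b that fchain.subspace_add[OF subspace_fboundaries]
      unfolding homology_class_def by blast
  qed
  assume cd: "c - d \<in> fboundaries p X"
  then have "d - c \<in> fboundaries p X"
    using fchain.subspace_neg[OF subspace_fboundaries cd] by simp
  with cd show "homology_class p X c = homology_class p X d"
    using * by blast
qed

lemma homology_class_0: "homology_class p X 0 = fboundaries p X"
  by (simp add: homology_class_def)

lemma homology_class_add:
  "homology_class p X c \<oplus>\<^bsub>homology p X\<^esub> homology_class p X d = homology_class p X (c + d)"
proof -
  have "{c' + d' | c' d'. c' \<in> homology_class p X c \<and> d' \<in> homology_class p X d}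
      = homology_class p X (c + d)" (is "?L = ?R")
  proof
    show "?L \<subseteq> ?R"
    proof
      fix e assume "e \<in> ?L"
      then obtain b b' where b: "b \<in> fboundaries p X" "b' \<in> fboundaries p X" "e = (c + b) + (d + b')"
        by (auto simp: homology_class_def)
      then have "e = (c + d) + (b + b')" by simp
      then show "e \<in> ?R" using b fchain.subspace_add[OF subspace_fboundaries]
        unfolding homology_class_def by blast
    qed
    show "?R \<subseteq> ?L"
    proof
      fix e assume "e \<in> ?R"
      then obtain b where b: "b \<in> fboundaries p X" "e = (c + b) + (d + 0)"
        by (auto simp: homology_class_def)
      then show "e \<in> ?L" using fchain.subspace_0[OF subspace_fboundaries]
        unfolding homology_class_def by blast
    qed
  qed
  then show ?thesis by (simp add: homology_def)
qed

text \<open>The boundary added in the definition of the scalar multiple matters for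
  \<open>a = 0\<close>, where scaling a coset elementwise would leave only the zero chain.\<close>

lemma homology_class_smult:
  "a \<odot>\<^bsub>homology p X\<^esub> homology_class p X c = homology_class p X (fchain_scale a c)"
proof -
  have "{fchain_scale a c' + b | c' b. c' \<in> homology_class p X c \<and> b \<in> fboundaries p X}
      = homology_class p X (fchain_scale a c)" (is "?L = ?R")
  proof
    show "?L \<subseteq> ?R"
    proof
      fix e assume "e \<in> ?L"
      then obtain b b' where b: "b \<in> fboundaries p X" "b' \<in> fboundaries p X"
          "e = fchain_scale a (c + b) + b'"
        by (auto simp: homology_class_def)
      then have "e = fchain_scale a c + (fchain_scale a b + b')"
        by (simp add: fchain.scale_right_distrib)
      then show "e \<in> ?R"
        using b fchain.subspace_add[OF subspace_fboundaries] fchain.subspace_scale[OF subspace_fboundaries]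
        unfolding homology_class_def by blast
    qed
    show "?R \<subseteq> ?L"
    proof
      fix e assume "e \<in> ?R"
      then obtain b where b: "b \<in> fboundaries p X" "e = fchain_scale a (c + 0) + b"
        by (auto simp: homology_class_def)
      then show "e \<in> ?L" using fchain.subspace_0[OF subspace_fboundaries]
        unfolding homology_class_def by blast
    qed
  qed
  then show ?thesis by (simp add: homology_def)
qed

lemma carrier_homology: "carrier (homology p X) = homology_class p X ` fcycles p X"
  and zero_homology: "\<zero>\<^bsub>homology p X\<^esub> = homology_class p X 0"
  by (simp_all add: homology_def homology_class_0)

text \<open>Supplies the laws of \<open>finsum\<close>, through which linear combinations are
  defined.\<close>

lemma abelian_monoid_homology: "abelian_monoid (homology p X)"
proof (rule abelian_monoidI)
  show "\<zero>\<^bsub>homology p X\<^esub> \<in> carrier (homology p X)"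
    using fchain.subspace_0[OF subspace_fcycles] by (auto simp: carrier_homology zero_homology)
qed (auto simp: carrier_homology zero_homology homology_class_add add_ac
    intro!: imageI fchain.subspace_add[OF subspace_fcycles])

text \<open>The left side sums over a set of classes. Injectivity on \<open>T\<close> ensures that
  no two representatives collapse to one summand.\<close>

lemma module_lincomb_homology_class:
  assumes "finite T" "T \<subseteq> fcycles p X" "inj_on (homology_class p X) T"
  shows "module_lincomb (homology p X) a (homology_class p X ` T) =
         homology_class p X (\<Sum>c\<in>T. fchain_scale (a (homology_class p X c)) c)"
  using assms
proof (induction T)
  case empty
  interpret abelian_monoid "homology p X" by (rule abelian_monoid_homology)
  show ?case by (simp add: module_lincomb_def zero_homology)
next
  case (insert c T)
  interpret abelian_monoid "homology p X" by (rule abelian_monoid_homology)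
  have smult: "a C \<odot>\<^bsub>homology p X\<^esub> C \<in> carrier (homology p X)"
    if "C \<in> homology_class p X ` insert c T" for C
    using that insert.prems
    by (auto simp: homology_class_smult carrier_homology
        intro!: imageI fchain.subspace_scale[OF subspace_fcycles])
  have "homology_class p X c \<notin> homology_class p X ` T"
    using insert.hyps insert.prems by auto
  then have "module_lincomb (homology p X) a (homology_class p X ` insert c T) =
      a (homology_class p X c) \<odot>\<^bsub>homology p X\<^esub> homology_class p X c \<oplus>\<^bsub>homology p X\<^esub>
      module_lincomb (homology p X) a (homology_class p X ` T)"
    unfolding module_lincomb_def image_insert
    using insert.hyps smult by (intro finsum_insert) auto
  also have "\<dots> = homology_class p X (\<Sum>c\<in>insert c T. fchain_scale (a (homology_class p X c)) c)"
    using insert by (simp add: homology_class_smult homology_class_add)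
  finally show ?case .
qed

text \<open>Coefficients are indexed by classes in \<open>module_finite_basis\<close> and by
  representatives in \<open>quotient_basis\<close>; \<open>inv_into T h\<close> translates between
  the two.\<close>

lemma all_coefficients_iff:
  assumes "inj_on h T" "\<And>a b. (\<And>c. c \<in> T \<Longrightarrow> a c = b c) \<Longrightarrow> P a = P b"
  shows "(\<forall>a. P (\<lambda>c. a (h c))) \<longleftrightarrow> (\<forall>a. P a)"
proof (intro iffI allI)
  fix a assume "\<forall>a. P (\<lambda>c. a (h c))"
  then have "P (\<lambda>c. (a \<circ> inv_into T h) (h c))" by blast
  then show "P a"
    using assms(2)[of "\<lambda>c. (a \<circ> inv_into T h) (h c)" a] assms(1) by simp
qed auto

lemma module_finite_basis_homology_iff:
  assumes Z: "Z \<subseteq> fcycles p X" and T: "finite T" "T \<subseteq> Z" "inj_on (homology_class p X) T"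
  shows "module_finite_basis (homology p X) (homology_class p X ` Z) (homology_class p X ` T) \<longleftrightarrow>
         quotient_basis fchain_scale Z (fboundaries p X) T"
proof -
  let ?h = "homology_class p X" and ?B = "fboundaries p X" and ?M = "homology p X"
  have lin: "module_lincomb ?M a (?h ` T) = ?h (\<Sum>c\<in>T. fchain_scale (a (?h c)) c)" for a
    using assms by (intro module_lincomb_homology_class) auto
  have ind: "(\<forall>a. module_lincomb ?M a (?h ` T) = \<zero>\<^bsub>?M\<^esub> \<longrightarrow> (\<forall>C\<in>?h ` T. a C = 0)) \<longleftrightarrow>
      (\<forall>a. (\<Sum>c\<in>T. fchain_scale (a c) c) \<in> ?B \<longrightarrow> (\<forall>c\<in>T. a c = 0))"
  proof -
    have "(\<forall>a. module_lincomb ?M a (?h ` T) = \<zero>\<^bsub>?M\<^esub> \<longrightarrow> (\<forall>C\<in>?h ` T. a C = 0)) \<longleftrightarrow>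
       (\<forall>a. (\<Sum>c\<in>T. fchain_scale (a (?h c)) c) \<in> ?B \<longrightarrow> (\<forall>c\<in>T. a (?h c) = 0))"
      by (simp add: lin zero_homology homology_class_eq_iff)
    also have "\<dots> \<longleftrightarrow> (\<forall>a. (\<Sum>c\<in>T. fchain_scale (a c) c) \<in> ?B \<longrightarrow> (\<forall>c\<in>T. a c = 0))"
      by (rule all_coefficients_iff[OF T(3), where P = "\<lambda>a. (\<Sum>c\<in>T. fchain_scale (a c) c) \<in> ?B \<longrightarrow> (\<forall>c\<in>T. a c = 0)"])
        (simp cong: sum.cong)
    finally show ?thesis .
  qed
  have span: "(?h z \<in> range (\<lambda>a. module_lincomb ?M a (?h ` T))) \<longleftrightarrow>
      (\<exists>a. z - (\<Sum>c\<in>T. fchain_scale (a c) c) \<in> ?B)" for z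
  proof -
    have "(?h z \<in> range (\<lambda>a. module_lincomb ?M a (?h ` T))) \<longleftrightarrow>
        \<not> (\<forall>a. z - (\<Sum>c\<in>T. fchain_scale (a (?h c)) c) \<notin> ?B)"
      by (auto simp: lin homology_class_eq_iff image_iff)
    also have "\<dots> \<longleftrightarrow> \<not> (\<forall>a. z - (\<Sum>c\<in>T. fchain_scale (a c) c) \<notin> ?B)"
      by (subst all_coefficients_iff[OF T(3), where P = "\<lambda>a. z - (\<Sum>c\<in>T. fchain_scale (a c) c) \<notin> ?B"])
        (simp_all cong: sum.cong)
    finally show ?thesis by blast
  qed
  show ?thesis
    unfolding module_finite_basis_def quotient_basis_def ind image_subset_iff span
    using T by auto
qed

text \<open>One representative is chosen for each class of the basis.\<close>

lemma module_finite_basis_homologyE: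
  assumes Z: "Z \<subseteq> fcycles p X"
    and S: "module_finite_basis (homology p X) (homology_class p X ` Z) S"
  obtains T where "quotient_basis fchain_scale Z (fboundaries p X) T" "card T = card S"
proof -
  have "S \<subseteq> homology_class p X ` Z" "finite S"
    using S by (auto simp: module_finite_basis_def)
  then obtain T where T: "T \<subseteq> Z" "inj_on (homology_class p X) T" "S = homology_class p X ` T"
    by (auto simp: subset_image_inj)
  then have "finite T" using \<open>finite S\<close> by (simp add: finite_image_iff)
  then have "quotient_basis fchain_scale Z (fboundaries p X) T"
    using module_finite_basis_homology_iff[OF Z _ T(1,2)] S T(3) by simp
  moreover have "card T = card S" using T by (simp add: card_image)
  ultimately show ?thesis by (rule that)
qed

text \<open>Every basis lifts to a \<open>quotient_basis\<close>, and any two of these have equal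
  size, so the basis picked by \<open>SOME\<close> is immaterial.\<close>

lemma module_dim_homology_eq_card:
  assumes Z: "Z \<subseteq> fcycles p X" and T: "quotient_basis fchain_scale Z (fboundaries p X) T"
  shows "module_dim (homology p X) (homology_class p X ` Z) = card T"
proof -
  have "inj_on (homology_class p X) T"
    using quotient_basis_distinct[OF fchain.vector_space_axioms T] by (auto intro!: inj_onI simp: homology_class_eq_iff)
  moreover have "finite T" "T \<subseteq> Z" using T by (auto simp: quotient_basis_def)
  ultimately have "module_finite_basis (homology p X) (homology_class p X ` Z) (homology_class p X ` T)"
    using module_finite_basis_homology_iff[OF Z] T by simp
  then have ex: "\<exists>S. module_finite_basis (homology p X) (homology_class p X ` Z) S" by (rule exI)
  have "card S = card T" if S: "module_finite_basis (homology p X) (homology_class p X ` Z) S" for S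
  proof -
    obtain T' where T': "quotient_basis fchain_scale Z (fboundaries p X) T'" "card T' = card S"
      using module_finite_basis_homologyE[OF Z S] .
    note le = card_quotient_basis_le[OF fchain.vector_space_axioms subspace_fboundaries]
    show ?thesis using le[OF T T'(1)] le[OF T'(1) T] T'(2) by simp
  qed
  note card_eq = this
  show ?thesis unfolding module_dim_def if_P[OF ex] by (rule card_eq[OF someI_ex[OF ex]])
qed

text \<open>Covers the default value of \<open>module_dim\<close>, so that ranks can be compared
  before they are known to be finite.\<close>

lemma module_dim_homology_eq_0:
  assumes "Z \<subseteq> fcycles p X" "\<nexists>T. quotient_basis fchain_scale Z (fboundaries p X) T"
  shows "module_dim (homology p X) (homology_class p X ` Z) = 0"
proof -
  have "\<nexists>S. module_finite_basis (homology p X) (homology_class p X ` Z) S"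
    using module_finite_basis_homologyE[OF assms(1)] assms(2) by metis
  then show ?thesis unfolding module_dim_def by (rule if_not_P)
qed

section \<open>Transport of bases and ranks along homeomorphisms\<close>

lemma quotient_basis_fchain_map:
  fixes T :: "('a, 'f::field) fchain set"
  assumes fg: "homeomorphic_maps X Y f g"
    and Z: "Z \<subseteq> fchains p X"
    and T: "quotient_basis fchain_scale Z (fboundaries p X) T"
  shows "quotient_basis fchain_scale (fchain_map p f ` Z) (fboundaries p Y) (fchain_map p f ` T)"
    and "card (fchain_map p f ` T) = card T"
proof -
  have f: "continuous_map X Y f" and g: "continuous_map Y X g"
    and gf: "\<And>x. x \<in> topspace X \<Longrightarrow> g (f x) = x"
    using fg by (auto simp: homeomorphic_maps_def)
  let ?F = "fchain_map p f :: ('a, 'f) fchain \<Rightarrow> _"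
  have finT: "finite T" and TZ: "T \<subseteq> Z" using T by (auto simp: quotient_basis_def)
  have inj: "inj_on ?F T"
    by (rule inj_on_inverseI[of _ "fchain_map p g"]) (use TZ Z fchain_map_inverse[OF f gf] in blast)
  then show "card (?F ` T) = card T" by (rule card_image)
  have reindex: "(\<Sum>x\<in>?F ` T. fchain_scale (a x) x) = ?F (\<Sum>x\<in>T. fchain_scale (a (?F x)) x)" for a
    by (simp add: sum.reindex[OF inj] fchain_map.sum fchain_map.scale)
  \<comment> \<open>Boundaries are reflected as well as preserved: pulling back along
    \<open>g\<close> recovers \<open>c\<close>. Hence relations modulo boundaries of
    \<open>Y\<close> come from relations modulo boundaries of \<open>X\<close>.\<close>
  have bd: "c \<in> fboundaries p X" if "c \<in> fchains p X" "?F c \<in> fboundaries p Y" for c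
    using fchain_map_in_fboundaries[OF g that(2)] fchain_map_inverse[OF f gf that(1)] by simp
  have "\<forall>x\<in>T. a (?F x) = 0" if "(\<Sum>x\<in>?F ` T. fchain_scale (a x) x) \<in> fboundaries p Y" for a
  proof -
    have "(\<Sum>x\<in>T. fchain_scale (a (?F x)) x) \<in> fchains p X"
      using TZ Z by (intro fchain.subspace_sum[OF subspace_fchains]
          fchain.subspace_scale[OF subspace_fchains]) auto
    then have "(\<Sum>x\<in>T. fchain_scale (a (?F x)) x) \<in> fboundaries p X"
      using that bd by (simp add: reindex)
    then show ?thesis using T by (auto simp: quotient_basis_def dest: spec[of _ "\<lambda>x. a (?F x)"])
  qed
  moreover have "\<exists>a. ?F z - (\<Sum>x\<in>?F ` T. fchain_scale (a x) x) \<in> fboundaries p Y" if "z \<in> Z" for z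
  proof -
    obtain a where a: "z - (\<Sum>x\<in>T. fchain_scale (a x) x) \<in> fboundaries p X"
      using T \<open>z \<in> Z\<close> by (auto simp: quotient_basis_def)
    have "(\<Sum>x\<in>T. fchain_scale ((a \<circ> inv_into T ?F) (?F x)) x) = (\<Sum>x\<in>T. fchain_scale (a x) x)"
      using inj by (intro sum.cong) auto
    then have "?F z - (\<Sum>x\<in>?F ` T. fchain_scale ((a \<circ> inv_into T ?F) x) x) =
        ?F (z - (\<Sum>x\<in>T. fchain_scale (a x) x))"
      by (simp only: reindex fchain_map.diff)
    also have "\<dots> \<in> fboundaries p Y" using fchain_map_in_fboundaries[OF f a] .
    finally show ?thesis by (rule exI[of _ "a \<circ> inv_into T ?F"])
  qed
  ultimately show "quotient_basis fchain_scale (?F ` Z) (fboundaries p Y) (?F ` T)"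
    using finT TZ by (auto simp: quotient_basis_def)
qed

text \<open>Boundaries of \<open>A\<close> are boundaries of \<open>B\<close>, so the class in
  \<open>A\<close> of a cycle is sent to its class in \<open>B\<close>. The rank thus involves only
  chains of \<open>B\<close>.\<close>

lemma inclusion_rank_eq_module_dim:
  fixes F :: "'f::field itself"
  assumes "A \<subseteq> B"
  shows "inclusion_rank F p A B =
    module_dim (homology p (top_of_set B))
      (homology_class p (top_of_set B) ` (fcycles p (top_of_set A) :: ('a::topological_space, 'f) fchain set))"
    and "(fcycles p (top_of_set A) :: ('a, 'f) fchain set) \<subseteq> fcycles p (top_of_set B)"
proof -
  have mono: "(fchains q (top_of_set A) :: ('a, 'f) fchain set) \<subseteq> fchains q (top_of_set B)" for q
    using singular_simplex_mono[OF _ assms, of q euclidean] unfolding fchains_def by blast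
  then show "(fcycles p (top_of_set A) :: ('a, 'f) fchain set) \<subseteq> fcycles p (top_of_set B)"
    by (auto simp: fcycles_def)
  have bd: "(fboundaries p (top_of_set A) :: ('a, 'f) fchain set) \<subseteq> fboundaries p (top_of_set B)"
    using mono by (auto simp: fboundaries_def)
  have "homology_inclusion p (top_of_set B) (homology_class p (top_of_set A) c) =
      homology_class p (top_of_set B) c" for c :: "('a, 'f) fchain"
  proof -
    have "homology_class p (top_of_set B) d = homology_class p (top_of_set B) c"
      if "d \<in> homology_class p (top_of_set A) c" for d
      using that bd by (auto simp: homology_class_def[of _ "top_of_set A"] homology_class_eq_iff)
    moreover have "c \<in> homology_class p (top_of_set A) c"
      using fchain.subspace_0[OF subspace_fboundaries] by (force simp: homology_class_def)
    ultimately show ?thesis unfolding homology_inclusion_def by blast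
  qed
  then show "inclusion_rank F p A B =
    module_dim (homology p (top_of_set B))
      (homology_class p (top_of_set B) ` (fcycles p (top_of_set A) :: ('a::topological_space, 'f) fchain set))"
    by (simp add: inclusion_rank_def carrier_homology image_image)
qed

text \<open>A homeomorphism of the pairs matches the cycles of \<open>A\<close> with those of
  \<open>A'\<close> and the boundaries of \<open>B\<close> with those of \<open>B'\<close>.\<close>

lemma inclusion_rank_homeomorphism:
  fixes F :: "'f::field itself" and f :: "'a::topological_space \<Rightarrow> 'b::topological_space"
  assumes fg: "homeomorphism B B' f g" and AB: "A \<subseteq> B" and A': "A' = f ` A"
  shows "inclusion_rank F p A B = inclusion_rank F p A' B'"
proof -
  have AB': "A' \<subseteq> B'" using assms by (auto simp: homeomorphism_def)
  have gf: "homeomorphism B' B g f" using fg by (rule homeomorphism_symD)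
  have inv: "g (f x) = x" if "x \<in> A" for x
    using that AB homeomorphism_apply1[OF fg] by blast
  have inv': "f (g x) = x" if "x \<in> A'" for x
    using that AB' homeomorphism_apply2[OF fg] by blast
  have A: "g ` A' = A" unfolding A' image_image using inv by simp
  have "f \<in> B \<rightarrow> B'" "g \<in> B' \<rightarrow> B"
    using homeomorphism_image1[OF fg] homeomorphism_image2[OF fg] by (simp_all add: image_subset_iff_funcset[symmetric])
  then have maps: "homeomorphic_maps (top_of_set B) (top_of_set B') f g"
    using homeomorphism_cont1[OF fg] homeomorphism_cont2[OF fg] homeomorphism_apply1[OF fg]
      homeomorphism_apply2[OF fg]
    by (simp add: homeomorphic_maps_def)
  then have maps': "homeomorphic_maps (top_of_set B') (top_of_set B) g f"
    by (rule homeomorphic_maps_sym[THEN iffD1])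
  let ?C = "fcycles p (top_of_set A) :: ('a, 'f) fchain set"
  let ?C' = "fcycles p (top_of_set A') :: ('b, 'f) fchain set"
  have cf: "continuous_map (top_of_set A) (top_of_set A') f"
    using continuous_on_subset[OF homeomorphism_cont1[OF fg] AB] A'
    by (simp add: image_subset_iff_funcset[symmetric])
  have cg: "continuous_map (top_of_set A') (top_of_set A) g"
    using continuous_on_subset[OF homeomorphism_cont2[OF fg] AB'] A
    by (simp add: image_subset_iff_funcset[symmetric])
  have C': "fchain_map p f ` ?C = ?C'"
  proof
    show "fchain_map p f ` ?C \<subseteq> ?C'" using fchain_map_in_fcycles[OF cf] by blast
    have "c = fchain_map p f (fchain_map p g c)" if "c \<in> ?C'" for c
      using fchain_map_inverse[OF cg _ ] that inv' by (fastforce simp: fcycles_def)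
    then show "?C' \<subseteq> fchain_map p f ` ?C" using fchain_map_in_fcycles[OF cg] by blast
  qed
  have C: "fchain_map p g ` ?C' = ?C"
  proof -
    have "fchain_map p g (fchain_map p f c) = c" if "c \<in> ?C" for c
      using fchain_map_inverse[OF cf _ ] that inv by (fastforce simp: fcycles_def)
    then show ?thesis unfolding C'[symmetric] image_image by simp
  qed
  have sub: "?C \<subseteq> fcycles p (top_of_set B)" "?C' \<subseteq> fcycles p (top_of_set B')"
    using inclusion_rank_eq_module_dim(2) AB AB' by blast+
  then have ch: "?C \<subseteq> fchains p (top_of_set B)" "?C' \<subseteq> fchains p (top_of_set B')"
    by (auto simp: fcycles_def)
  show ?thesis
  \<comment> \<open>A finite basis on one side is carried to one of the same size. If there is none,
    transport along \<open>g\<close> excludes one on the other side, and both dimensions take the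
    default value 0.\<close>
  proof (cases "\<exists>T. quotient_basis fchain_scale ?C (fboundaries p (top_of_set B)) T")
    case True
    then obtain T where T: "quotient_basis fchain_scale ?C (fboundaries p (top_of_set B)) T" by blast
    show ?thesis
      using quotient_basis_fchain_map[OF maps ch(1) T]
        module_dim_homology_eq_card[OF sub(1) T] module_dim_homology_eq_card[OF sub(2)]
      by (simp add: inclusion_rank_eq_module_dim AB AB' C')
  next
    case False
    then have "\<nexists>T. quotient_basis fchain_scale ?C' (fboundaries p (top_of_set B')) T"
      using quotient_basis_fchain_map(1)[OF maps' ch(2)] by (auto simp: C)
    then show ?thesis
      using module_dim_homology_eq_0[OF sub(1) False] module_dim_homology_eq_0[OF sub(2)]
      by (simp add: inclusion_rank_eq_module_dim AB AB')
  qed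
qed

text \<open>Invariance of ranks then serves Euler curves as well as persistence diagrams.\<close>

lemma betti_eq_inclusion_rank: "betti F p A = inclusion_rank F p A A"
  by (simp add: betti_def inclusion_rank_eq_module_dim carrier_homology)

section \<open>Increasing homeomorphisms of the real line\<close>

lemma strict_mono_on_interpolation:
  fixes b :: "real \<Rightarrow> real"
  assumes "finite A" "strict_mono_on A b"
  obtains \<phi> where "strict_mono \<phi>" "surj \<phi>" "continuous_on UNIV \<phi>"
    "\<And>a. a \<in> A \<Longrightarrow> \<phi> a = b a" "\<And>a. a \<in> A \<Longrightarrow> (\<phi> has_real_derivative 1) (at a)"
proof -
  \<comment> \<open>Nodes are added from left to right. The last conjunct, slope 1 to the right of
    the largest node, leaves room to correct \<open>\<phi>\<close> before the next node; the bounded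
    distance from the identity yields surjectivity at the end.\<close>
  have "\<exists>\<phi> C. strict_mono \<phi> \<and> continuous_on UNIV \<phi> \<and> (\<forall>r. \<bar>\<phi> r - r\<bar> \<le> C) \<and>
      (\<forall>a\<in>A. \<phi> a = b a \<and> (\<phi> has_real_derivative 1) (at a)) \<and>
      (\<forall>m\<in>A. (\<forall>a\<in>A. a \<le> m) \<longrightarrow> (\<forall>r\<ge>m. \<phi> r = \<phi> m + (r - m)))"
    using assms
  proof (induction A rule: finite_linorder_max_induct)
    case empty
    show ?case by (rule exI[of _ id], rule exI[of _ 0]) (auto simp: strict_mono_def)
  next
    case (insert a A)
    then have "strict_mono_on A b" by (auto simp: strict_mono_on_def)
    with insert.IH obtain \<phi> C where \<phi>: "strict_mono \<phi>" "continuous_on UNIV \<phi>" "\<And>r. \<bar>\<phi> r - r\<bar> \<le> C"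
      "\<And>x. x \<in> A \<Longrightarrow> \<phi> x = b x" "\<And>x. x \<in> A \<Longrightarrow> (\<phi> has_real_derivative 1) (at x)"
      and lin: "\<And>m r. m \<in> A \<Longrightarrow> \<forall>a\<in>A. a \<le> m \<Longrightarrow> r \<ge> m \<Longrightarrow> \<phi> r = \<phi> m + (r - m)"
      by blast
    show ?case
    proof (cases "A = {}")
      case True
      have "((\<lambda>r. r + (b a - a)) has_real_derivative 1) (at a)"
        by (auto intro!: derivative_eq_intros)
      then show ?thesis
        by (intro exI[of _ "\<lambda>r. r + (b a - a)"] exI[of _ "\<bar>b a - a\<bar>"])
          (auto simp: True strict_mono_def intro!: continuous_intros)
    next
      case False
      define m where "m = Max A"
      have m: "m \<in> A" "\<forall>x\<in>A. x \<le> m" using False insert.hyps by (auto simp: m_def)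
      have ma: "m < a" "b m < b a"
        using m insert by (auto simp: strict_mono_on_def)
      \<comment> \<open>A quarter of the smaller gap keeps \<open>p < q\<close> and leaves
        neighbourhoods of \<open>m\<close> and \<open>a\<close> untouched by the change of slope. It
        also makes the target rise exceed \<open>2 * \<epsilon>\<close>, which is what
        \<open>d > -1\<close> amounts to.\<close>
      define \<epsilon> where "\<epsilon> = min (a - m) (b a - b m) / 4"
      have \<epsilon>: "\<epsilon> > 0" "4 * \<epsilon> \<le> a - m" "4 * \<epsilon> \<le> b a - b m" using ma by (auto simp: \<epsilon>_def)
      define p q where "p = m + \<epsilon>" and "q = a - \<epsilon>"
      have pq: "m < p" "p < q" "q < a" using \<epsilon> by (auto simp: p_def q_def)
      \<comment> \<open>The extra slope on \<open>[p, q]\<close> that makes the total rise from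
        \<open>m\<close> to \<open>a\<close> equal to \<open>b a - b m\<close>.\<close>
      define d where "d = ((b a - b m) - (a - m)) / (q - p)"
      have d: "d > -1" "d * (q - p) = (b a - b m) - (a - m)"
        using pq \<epsilon> by (auto simp: d_def field_simps) (auto simp: p_def q_def)
      text \<open>The correction \<open>g\<close> is constant outside \<open>[p, q]\<close>, so it does not affect the
        derivatives at the interpolation points.\<close>
      define g where "g r = d * (min (max r p) q - p)" for r
      define \<psi> where "\<psi> r = \<phi> r + g r" for r
      have g_lo: "g r = 0" if "r \<le> p" for r using that pq by (simp add: g_def)
      have g_hi: "g r = (b a - b m) - (a - m)" if "r \<ge> q" for r using that pq d by (simp add: g_def)
      have \<phi>_lin: "\<phi> r = b m + (r - m)" if "r \<ge> m" for r using lin[OF m that] \<phi>(4)[OF m(1)] by simp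
      have \<psi>_hi: "\<psi> r = b a + (r - a)" if "r \<ge> q" for r
        using that pq \<phi>_lin[of r] g_hi by (simp add: \<psi>_def)
      \<comment> \<open>To the left of \<open>m\<close> only monotonicity of \<open>\<phi>\<close>
        is available, so the comparison passes through \<open>m\<close>. From \<open>m\<close> on,
        \<open>\<phi>\<close> has slope 1, and \<open>d > -1\<close> bounds what \<open>g\<close>
        can subtract.\<close>
      have "\<psi> r < \<psi> s" if "r < s" for r s
      proof (cases "r < m")
        case True
        show ?thesis
        proof (cases "s \<le> m")
          case True
          then show ?thesis using \<open>r < m\<close> \<phi>(1) that pq by (simp add: \<psi>_def g_lo strict_monoD)
        next
          case False
          have "g s \<ge> - (s - m)"
          proof -
            have "min (max s p) q - p \<le> s - m" "0 \<le> min (max s p) q - p" using False pq by auto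
            moreover have "(-1) * (min (max s p) q - p) \<le> d * (min (max s p) q - p)"
              using calculation d by (intro mult_right_mono) auto
            ultimately show ?thesis by (simp add: g_def)
          qed
          moreover have "\<phi> r < \<phi> m" using \<open>r < m\<close> \<phi>(1) by (simp add: strict_monoD)
          ultimately show ?thesis
            using \<phi>_lin[of s] \<phi>_lin[of m] False \<open>r < m\<close> pq by (simp add: \<psi>_def g_lo)
        qed
      next
        case False
        define \<delta> where "\<delta> = min (max s p) q - min (max r p) q"
        have \<delta>: "0 \<le> \<delta>" "\<delta> \<le> s - r" using that by (auto simp: \<delta>_def)
        have "g s - g r = d * \<delta>" by (simp add: g_def \<delta>_def algebra_simps)
        also have "d * \<delta> > - (s - r)"
        proof (cases "\<delta> = 0")
          case False
          then have "(-1) * \<delta> < d * \<delta>" using \<delta> d by (intro mult_strict_right_mono) auto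
          then show ?thesis using \<delta> by linarith
        qed (use that in simp)
        finally show ?thesis
          using \<phi>_lin[of s] \<phi>_lin[of r] False that by (simp add: \<psi>_def)
      qed
      then have mono: "strict_mono \<psi>" by (simp add: strict_mono_def)
      have cont: "continuous_on UNIV \<psi>"
        unfolding \<psi>_def g_def by (intro continuous_intros \<phi>)
      have bound: "\<bar>\<psi> r - r\<bar> \<le> C + \<bar>d\<bar> * (q - p)" for r
      proof -
        have "\<bar>g r\<bar> \<le> \<bar>d\<bar> * (q - p)"
          unfolding g_def abs_mult using pq by (intro mult_left_mono) auto
        then show ?thesis using \<phi>(3)[of r] by (simp add: \<psi>_def)
      qed
      have old: "\<psi> x = b x \<and> (\<psi> has_real_derivative 1) (at x)" if "x \<in> A" for x
      proof -
        have x: "x < p" using that m pq by force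
        have "(\<psi> has_real_derivative 1) (at x)"
          by (rule has_field_derivative_transform_within[OF \<phi>(5)[OF that], of "p - x"])
            (use x in \<open>auto simp: \<psi>_def g_lo dist_real_def\<close>)
        then show ?thesis using x \<phi>(4)[OF that] by (simp add: \<psi>_def g_lo)
      qed
      have new: "\<psi> a = b a" using \<psi>_hi[of a] pq by simp
      have new': "(\<psi> has_real_derivative 1) (at a)"
      proof (rule has_field_derivative_transform_within[of "\<lambda>r. b a + (r - a)" _ _ _ "a - q"])
        show "((\<lambda>r. b a + (r - a)) has_real_derivative 1) (at a)"
          by (auto intro!: derivative_eq_intros)
      qed (use pq \<psi>_hi in \<open>auto simp: dist_real_def\<close>)
      have lin': "\<psi> r = \<psi> x + (r - x)" if "x \<in> insert a A" "\<forall>y\<in>insert a A. y \<le> x" "x \<le> r" for x r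
      proof -
        have "a \<le> x" using that(2) by simp
        then have "x = a" using bspec[OF insert.hyps(2), of x] that(1) by auto
        then show ?thesis using that pq \<psi>_hi[of r] \<psi>_hi[of a] by simp
      qed
      show ?thesis
      proof (intro exI conjI)
        show "strict_mono \<psi>" "continuous_on UNIV \<psi>" by fact+
        show "\<forall>r. \<bar>\<psi> r - r\<bar> \<le> C + \<bar>d\<bar> * (q - p)" using bound by blast
        show "\<forall>x\<in>insert a A. \<psi> x = b x \<and> (\<psi> has_real_derivative 1) (at x)"
          using old new new' by blast
        show "\<forall>m\<in>insert a A. (\<forall>x\<in>insert a A. x \<le> m) \<longrightarrow> (\<forall>r\<ge>m. \<psi> r = \<psi> m + (r - m))"
          using lin' by blast
      qed
    qed
  qed
  then obtain \<phi> C where \<phi>: "strict_mono \<phi>" "continuous_on UNIV \<phi>" "\<And>r. \<bar>\<phi> r - r\<bar> \<le> C"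
    "\<And>a. a \<in> A \<Longrightarrow> \<phi> a = b a" "\<And>a. a \<in> A \<Longrightarrow> (\<phi> has_real_derivative 1) (at a)"
    by blast
  have "\<exists>x. \<phi> x = y" for y
  proof -
    \<comment> \<open>The bound \<open>C\<close> brackets \<open>y\<close> between two values of
      \<open>\<phi>\<close> for the intermediate value theorem.\<close>
    have "\<phi> (y - C) \<le> y" "y \<le> \<phi> (y + C)" "y - C \<le> y + C"
      using \<phi>(3)[of "y - C"] \<phi>(3)[of "y + C"] by linarith+
    then show ?thesis
      using IVT'[of \<phi> "y - C" y "y + C"] continuous_on_subset[OF \<phi>(2)] by blast
  qed
  then show ?thesis using that \<phi> by (metis surjI)
qed

section \<open>Barycentric coordinates\<close>

text \<open>The differences \<open>z - x\<close> are linearly independent, so some linear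
  \<open>L\<close> equals 1 on all of them; \<open>1 - L (y - x)\<close> then reads off the
  coordinate at \<open>x\<close>. This yields both uniqueness and continuity of coordinates.\<close>

lemma affine_independent_coordinate_map:
  fixes V :: "'a::euclidean_space set"
  assumes V: "\<not> affine_dependent V" and x: "x \<in> V"
  obtains f :: "'a \<Rightarrow> real" where "continuous_on UNIV f"
    "\<And>u. sum u V = 1 \<Longrightarrow> f (\<Sum>z\<in>V. u z *\<^sub>R z) = u x"
proof -
  have fin: "finite V" using V by (rule aff_independent_finite)
  have "independent ((\<lambda>z. - x + z) ` (V - {x}))"
    using V x affine_dependent_iff_dependent2 by blast
  then obtain L :: "'a \<Rightarrow> real" where L: "linear L"
    "\<And>y. y \<in> (\<lambda>z. - x + z) ` (V - {x}) \<Longrightarrow> L y = 1"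
    using linear_independent_extend[of _ "\<lambda>_. 1"] by metis
  have "1 - L ((\<Sum>z\<in>V. u z *\<^sub>R z) - x) = u x" if u: "sum u V = 1" for u
  proof -
    have "(\<Sum>z\<in>V. u z *\<^sub>R z) - x = (\<Sum>z\<in>V. u z *\<^sub>R (- x + z))"
      using u by (simp add: scaleR_right_diff_distrib sum_subtractf scaleR_sum_left[symmetric])
    also have "\<dots> = (\<Sum>z\<in>V - {x}. u z *\<^sub>R (- x + z))"
      using fin x by (simp add: sum.remove)
    finally have "L ((\<Sum>z\<in>V. u z *\<^sub>R z) - x) = (\<Sum>z\<in>V - {x}. u z * L (- x + z))"
      using L(1) by (simp add: linear_sum linear_cmul)
    also have "\<dots> = (\<Sum>z\<in>V - {x}. u z)" using L(2) by (intro sum.cong) auto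
    also have "\<dots> = 1 - u x" using u fin x by (simp add: sum.remove)
    finally show ?thesis by simp
  qed
  moreover have "continuous_on UNIV (\<lambda>y. 1 - L (y - x))"
    by (rule continuous_on_diff[OF continuous_on_const linear_continuous_on_compose[OF _ L(1)]])
      (intro continuous_intros)
  ultimately show ?thesis by (rule that[rotated])
qed

lemma affine_independent_coordinates_unique:
  fixes V :: "'a::euclidean_space set"
  assumes "\<not> affine_dependent V" "sum u V = 1" "sum u' V = 1"
    and "(\<Sum>z\<in>V. u z *\<^sub>R z) = (\<Sum>z\<in>V. u' z *\<^sub>R z)" and "x \<in> V"
  shows "u x = u' x"
  using affine_independent_coordinate_map[OF assms(1,5)] assms(2-4) by metis

section \<open>Coordinates on the polyhedron of a simplicial complex\<close>

lemma finite_vertex_set: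
  assumes "simplicial_complex K"
  shows "finite (vertex_set K)"
proof -
  have "vertex_set K = (\<lambda>x. {x}) -` K" by (auto simp: vertex_set_def)
  then show ?thesis
    using assms by (simp add: simplicial_complex_def finite_vimageI)
qed

text \<open>The vertices spanning \<open>S\<close> are its extreme points, that is, its singleton
  faces. Closure under faces puts these singletons into \<open>K\<close>; conversely, a singleton of
  \<open>K\<close> inside \<open>S\<close> meets \<open>S\<close> in a face.\<close>

lemma simplicial_complex_simplex:
  assumes K: "simplicial_complex K" and S: "S \<in> K"
  shows "S = convex hull (vertex_set K \<inter> S)" "\<not> affine_dependent (vertex_set K \<inter> S)"
proof -
  obtain C where C: "\<not> affine_dependent C" "S = convex hull C"
    using K S by (auto simp: simplicial_complex_def simplex_def)
  have "x \<in> C \<longleftrightarrow> x \<in> vertex_set K \<inter> S" for x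
  proof -
    have "x \<in> C \<longleftrightarrow> {x} face_of S"
      using extreme_point_of_convex_hull_affine_independent[OF C(1)] C(2)
      by (simp add: face_of_singleton)
    also have "\<dots> \<longleftrightarrow> {x} \<in> K \<and> x \<in> S"
    proof
      assume "{x} face_of S"
      then show "{x} \<in> K \<and> x \<in> S"
        using K S face_of_imp_subset by (auto simp: simplicial_complex_def)
    next
      assume *: "{x} \<in> K \<and> x \<in> S"
      then have "S \<inter> {x} face_of S" using K S unfolding simplicial_complex_def by blast
      then show "{x} face_of S" using * by simp
    qed
    finally show ?thesis by (simp add: vertex_set_def)
  qed
  then have "C = vertex_set K \<inter> S" by blast
  then show "S = convex hull (vertex_set K \<inter> S)" "\<not> affine_dependent (vertex_set K \<inter> S)"
    using C by simp_all
qed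

text \<open>Coordinates are functions on the whole space vanishing off one simplex, so coordinates
  taken in different simplices can be compared as functions.\<close>

definition barycentric :: "'a::euclidean_space set set \<Rightarrow> ('a \<Rightarrow> real) \<Rightarrow> bool" where
  "barycentric K u \<longleftrightarrow> (\<forall>x. 0 \<le> u x) \<and> sum u (vertex_set K) = 1 \<and>
     (\<exists>S\<in>K. \<forall>x. u x \<noteq> 0 \<longrightarrow> x \<in> vertex_set K \<inter> S)"

definition barycentric_point :: "'a::euclidean_space set set \<Rightarrow> ('a \<Rightarrow> real) \<Rightarrow> 'a" where
  "barycentric_point K u = (\<Sum>x\<in>vertex_set K. u x *\<^sub>R x)"

definition barycentric_coords :: "'a::euclidean_space set set \<Rightarrow> 'a \<Rightarrow> 'a \<Rightarrow> real" where
  "barycentric_coords K y = (SOME u. barycentric K u \<and> barycentric_point K u = y)"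

context
  fixes K :: "'a::euclidean_space set set"
  assumes K: "simplicial_complex K"
begin

text \<open>Passes between sums over all vertices and sums over one simplex, where affine
  independence applies.\<close>

lemma sum_vertices_simplex:
  assumes "\<And>x. u x \<noteq> 0 \<Longrightarrow> x \<in> vertex_set K \<inter> S"
  shows "sum u (vertex_set K) = sum u (vertex_set K \<inter> S)"
    and "barycentric_point K u = (\<Sum>x\<in>vertex_set K \<inter> S. u x *\<^sub>R x)"
  unfolding barycentric_point_def
  by (rule sum.mono_neutral_right; use assms finite_vertex_set[OF K] in force)+

lemma simplex_barycentric:
  assumes S: "S \<in> K" and y: "y \<in> S"
  obtains u where "barycentric K u" "barycentric_point K u = y"
    "\<And>x. u x \<noteq> 0 \<Longrightarrow> x \<in> vertex_set K \<inter> S"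
proof -
  let ?V = "vertex_set K \<inter> S"
  have "finite ?V" using finite_vertex_set[OF K] by simp
  moreover have "y \<in> convex hull ?V" using y simplicial_complex_simplex(1)[OF K S] by simp
  ultimately obtain u where u: "\<And>x. x \<in> ?V \<Longrightarrow> 0 \<le> u x" "sum u ?V = 1" "(\<Sum>x\<in>?V. u x *\<^sub>R x) = y"
    by (auto simp: convex_hull_finite)
  define u' where "u' x = (if x \<in> ?V then u x else 0)" for x
  have sup: "x \<in> ?V" if "u' x \<noteq> 0" for x using that by (simp add: u'_def split: if_splits)
  have "sum u' ?V = sum u ?V" "(\<Sum>x\<in>?V. u' x *\<^sub>R x) = (\<Sum>x\<in>?V. u x *\<^sub>R x)"
    by (auto intro!: sum.cong simp: u'_def)
  with u(2,3) have "sum u' (vertex_set K) = 1" "barycentric_point K u' = y"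
    using sum_vertices_simplex[of u' S, OF sup] by simp_all
  moreover have "barycentric K u'"
    unfolding barycentric_def
  proof (intro conjI)
    show "\<forall>x. 0 \<le> u' x" using u(1) by (simp add: u'_def)
    show "\<exists>S\<in>K. \<forall>x. u' x \<noteq> 0 \<longrightarrow> x \<in> vertex_set K \<inter> S" using S sup by blast
  qed fact
  ultimately show ?thesis using that sup by blast
qed

lemma barycentric_point_in_simplex:
  assumes u: "barycentric K u" and S: "S \<in> K" "\<And>x. u x \<noteq> 0 \<Longrightarrow> x \<in> vertex_set K \<inter> S"
  shows "barycentric_point K u \<in> S"
proof -
  have "finite (vertex_set K \<inter> S)" using finite_vertex_set[OF K] by simp
  moreover have "sum u (vertex_set K \<inter> S) = 1" "\<forall>x. 0 \<le> u x"
    using u sum_vertices_simplex(1)[of u S, OF S(2)] by (simp_all add: barycentric_def)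
  ultimately have "barycentric_point K u \<in> convex hull (vertex_set K \<inter> S)"
    using sum_vertices_simplex(2)[of u S, OF S(2)] by (auto simp: convex_hull_finite)
  then show ?thesis using simplicial_complex_simplex(1)[OF K S(1)] by simp
qed

lemma barycentric_point_in_polyhedron:
  assumes u: "barycentric K u"
  shows "barycentric_point K u \<in> \<Union>K"
proof -
  obtain S where S: "S \<in> K" "\<And>x. u x \<noteq> 0 \<Longrightarrow> x \<in> vertex_set K \<inter> S"
    using u by (auto simp: barycentric_def)
  then show ?thesis using barycentric_point_in_simplex[OF u S] by blast
qed

lemma barycentric_eq_in_simplex:
  assumes u: "barycentric K u" "\<And>x. u x \<noteq> 0 \<Longrightarrow> x \<in> vertex_set K \<inter> S" and S: "S \<in> K"
    and u': "barycentric K u'" "\<And>x. u' x \<noteq> 0 \<Longrightarrow> x \<in> vertex_set K \<inter> S"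
    and eq: "barycentric_point K u = barycentric_point K u'"
  shows "u = u'"
proof
  fix x
  show "u x = u' x"
  proof (cases "x \<in> vertex_set K \<inter> S")
    case True
    have "sum u (vertex_set K \<inter> S) = 1" "sum u' (vertex_set K \<inter> S) = 1"
      "(\<Sum>x\<in>vertex_set K \<inter> S. u x *\<^sub>R x) = (\<Sum>x\<in>vertex_set K \<inter> S. u' x *\<^sub>R x)"
      using u(1) u'(1) eq sum_vertices_simplex[of u S, OF u(2)] sum_vertices_simplex[of u' S, OF u'(2)]
      by (simp_all add: barycentric_def)
    then show ?thesis
      using affine_independent_coordinates_unique simplicial_complex_simplex(2)[OF K S] True by blast
  next
    case False
    then show ?thesis using u(2) u'(2) by metis
  qed
qed

text \<open>The carriers \<open>S\<close> and \<open>S'\<close> meet in a simplex of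
  \<open>K\<close> containing the point. Coordinates \<open>c\<close> taken there are supported in
  both carriers, so they agree with \<open>u\<close> inside \<open>S\<close> and with
  \<open>u'\<close> inside \<open>S'\<close>.\<close>

lemma barycentric_unique:
  assumes u: "barycentric K u" and u': "barycentric K u'"
    and eq: "barycentric_point K u = barycentric_point K u'"
  shows "u = u'"
proof -
  obtain S where S: "S \<in> K" "\<And>x. u x \<noteq> 0 \<Longrightarrow> x \<in> vertex_set K \<inter> S"
    using u by (auto simp: barycentric_def)
  obtain S' where S': "S' \<in> K" "\<And>x. u' x \<noteq> 0 \<Longrightarrow> x \<in> vertex_set K \<inter> S'"
    using u' by (auto simp: barycentric_def)
  have "S \<inter> S' \<in> K" using K S(1) S'(1) unfolding simplicial_complex_def by blast
  moreover have "barycentric_point K u \<in> S \<inter> S'"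
    using barycentric_point_in_simplex[OF u S] barycentric_point_in_simplex[OF u' S'] eq by simp
  ultimately obtain c where c: "barycentric K c" "barycentric_point K c = barycentric_point K u"
    "\<And>x. c x \<noteq> 0 \<Longrightarrow> x \<in> vertex_set K \<inter> (S \<inter> S')"
    by (rule simplex_barycentric) blast
  have "c = u" by (rule barycentric_eq_in_simplex[OF c(1) _ S(1) u S(2) c(2)]) (use c(3) in blast)
  moreover have "c = u'"
    by (rule barycentric_eq_in_simplex[OF c(1) _ S'(1) u' S'(2) c(2)[unfolded eq]]) (use c(3) in blast)
  ultimately show ?thesis by simp
qed

lemma barycentric_coords:
  assumes "y \<in> \<Union>K"
  shows "barycentric K (barycentric_coords K y)"
    and "barycentric_point K (barycentric_coords K y) = y"
proof -
  have "\<exists>u. barycentric K u \<and> barycentric_point K u = y"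
    using assms simplex_barycentric by (metis UnionE)
  from someI_ex[OF this] show "barycentric K (barycentric_coords K y)"
    "barycentric_point K (barycentric_coords K y) = y"
    by (simp_all add: barycentric_coords_def)
qed

lemma barycentric_coords_eq:
  assumes "barycentric K u" "barycentric_point K u = y"
  shows "barycentric_coords K y = u"
proof -
  have "y \<in> \<Union>K" using barycentric_point_in_polyhedron[OF assms(1)] assms(2) by simp
  then show ?thesis using barycentric_unique[OF barycentric_coords(1) assms(1)] barycentric_coords(2) assms(2)
    by simp
qed

lemma compact_simplex: "S \<in> K \<Longrightarrow> compact S"
  using simplicial_complex_simplex(1)[OF K] finite_vertex_set[OF K]
  by (metis compact_convex_hull finite_Int finite_imp_compact)

lemma compact_polyhedron: "compact (\<Union>K)"
  using K compact_simplex by (intro compact_Union) (auto simp: simplicial_complex_def)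

text \<open>On each simplex the coordinate is either zero or the restriction of a continuous
  function; finitely many closed simplices are then glued.\<close>

lemma continuous_on_barycentric_coords: "continuous_on (\<Union>K) (\<lambda>y. barycentric_coords K y x)"
proof -
  have fin: "finite K" using K by (simp add: simplicial_complex_def)
  have "continuous_on S (\<lambda>y. barycentric_coords K y x)" if S: "S \<in> K" for S
  proof -
    let ?V = "vertex_set K \<inter> S"
    \<comment> \<open>By uniqueness, the globally chosen coordinates of a point of \<open>S\<close>
      are those obtained inside \<open>S\<close>.\<close>
    have sup: "z \<in> ?V" if "barycentric_coords K y z \<noteq> 0" "y \<in> S" for y z
    proof -
      obtain u where "barycentric K u" "barycentric_point K u = y" "\<And>x. u x \<noteq> 0 \<Longrightarrow> x \<in> ?V"
        using simplex_barycentric[OF S \<open>y \<in> S\<close>] by blast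
      then show ?thesis using barycentric_coords_eq that by metis
    qed
    show ?thesis
    proof (cases "x \<in> ?V")
      case True
      obtain f :: "'a \<Rightarrow> real" where f: "continuous_on UNIV f"
        "\<And>u. sum u ?V = 1 \<Longrightarrow> f (\<Sum>z\<in>?V. u z *\<^sub>R z) = u x"
        using affine_independent_coordinate_map[OF simplicial_complex_simplex(2)[OF K S] True] by blast
      have "barycentric_coords K y x = f y" if y: "y \<in> S" for y
      proof -
        have "y \<in> \<Union>K" using S y by blast
        note b = barycentric_coords[OF this]
        show ?thesis
          using f(2)[of "barycentric_coords K y"] b
            sum_vertices_simplex[of "barycentric_coords K y" S, OF sup[OF _ y]]
          by (simp add: barycentric_def)
      qed
      then show ?thesis
        using continuous_on_subset[OF f(1), of S] by (simp cong: continuous_on_cong)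
    next
      case False
      then have "barycentric_coords K y x = 0" if "y \<in> S" for y using sup that by blast
      then show ?thesis by (simp cong: continuous_on_cong)
    qed
  qed
  then have "continuous_on (\<Union>S\<in>K. S) (\<lambda>y. barycentric_coords K y x)"
    using fin compact_imp_closed[OF compact_simplex] by (intro continuous_on_closed_Union)
  then show ?thesis by simp
qed

end

section \<open>Changing the direction of the height function\<close>

text \<open>
  The height \<open>r\<close> of a point is the zero of \<open>\<lambda>r. \<Sum> u\<^sub>x (x \<bullet> v - r)\<close>. The weights are
  chosen such that \<open>c\<^sub>x(r) (x \<bullet> w - \<phi> r) = x \<bullet> v - r\<close>, so rescaling the
  barycentric coordinates \<open>u\<^sub>x\<close> by \<open>c\<^sub>x(r)\<close> moves the level set \<open>r\<close> of the height in direction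
  \<open>v\<close> to the level set \<open>\<phi> r\<close> of the height in direction \<open>w\<close>. The condition on the derivative
  makes \<open>c\<^sub>x\<close> continuous at \<open>x \<bullet> v\<close>.
\<close>

lemma height_change_homeomorphism:
  fixes K :: "'a::euclidean_space set set" and v w :: 'a and \<phi> :: "real \<Rightarrow> real"
  assumes K: "simplicial_complex K"
    and mono: "strict_mono \<phi>" and surj: "surj \<phi>" and cont: "continuous_on UNIV \<phi>"
    and vertex: "\<And>x. x \<in> vertex_set K \<Longrightarrow> \<phi> (x \<bullet> v) = x \<bullet> w"
    and deriv: "\<And>x. x \<in> vertex_set K \<Longrightarrow> (\<phi> has_real_derivative 1) (at (x \<bullet> v))"
  obtains f g where "homeomorphism (\<Union>K) (\<Union>K) f g" "\<And>y. y \<in> \<Union>K \<Longrightarrow> f y \<bullet> w = \<phi> (y \<bullet> v)"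
proof -
  define X where "X = vertex_set K"
  have fin: "finite X" unfolding X_def by (rule finite_vertex_set[OF K])
  let ?u = "barycentric_coords K"
  define c where "c x r = (if r = x \<bullet> v then 1 else (r - x \<bullet> v) / (\<phi> r - x \<bullet> w))" for x r
  have c_eq: "c x r * (x \<bullet> w - \<phi> r) = x \<bullet> v - r" if "x \<in> X" for x r
  proof (cases "r = x \<bullet> v")
    case False
    then have "\<phi> r \<noteq> x \<bullet> w"
      using vertex[of x] that strict_mono_eq[OF mono, of r "x \<bullet> v"] by (simp add: X_def)
    then show ?thesis using False by (simp add: c_def divide_simps) (simp add: algebra_simps)
  qed (use vertex that in \<open>simp add: X_def\<close>)
  have c_pos: "0 < c x r" if "x \<in> X" for x r
  proof -
    have x: "\<phi> (x \<bullet> v) = x \<bullet> w" using vertex that by (simp add: X_def)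
    consider "r < x \<bullet> v" | "r = x \<bullet> v" | "x \<bullet> v < r" by linarith
    then show ?thesis
    proof cases
      case 1
      then have "\<phi> r < x \<bullet> w" using strict_monoD[OF mono] x by fastforce
      then show ?thesis using 1 by (simp add: c_def divide_neg_neg)
    next
      case 3
      then have "x \<bullet> w < \<phi> r" using strict_monoD[OF mono] x by fastforce
      then show ?thesis using 3 by (simp add: c_def)
    qed (simp add: c_def)
  qed
  have c_cont: "continuous_on UNIV (c x)" if x: "x \<in> X" for x
  proof -
    have "isCont (c x) r" for r
    proof (cases "r = x \<bullet> v")
      case True
      \<comment> \<open>Away from \<open>x \<bullet> v\<close> the weight is the inverse of this
        difference quotient, so its limit is 1, the value assigned at the exceptional point.\<close>
      have "((\<lambda>s. (\<phi> s - \<phi> (x \<bullet> v)) / (s - x \<bullet> v)) \<longlongrightarrow> 1) (at (x \<bullet> v))"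
        using deriv x by (simp add: has_field_derivative_iff X_def)
      then have "((\<lambda>s. inverse ((\<phi> s - \<phi> (x \<bullet> v)) / (s - x \<bullet> v))) \<longlongrightarrow> inverse 1) (at (x \<bullet> v))"
        by (rule tendsto_inverse) simp
      moreover have "\<forall>\<^sub>F s in at (x \<bullet> v). inverse ((\<phi> s - \<phi> (x \<bullet> v)) / (s - x \<bullet> v)) = c x s"
        unfolding eventually_at_filter
        by (rule always_eventually) (use vertex x in \<open>simp add: c_def X_def\<close>)
      ultimately have "(c x \<longlongrightarrow> 1) (at (x \<bullet> v))"
        by (simp add: tendsto_cong)
      then show ?thesis using True by (simp add: isCont_def c_def)
    next
      case False
      then have "\<phi> r \<noteq> x \<bullet> w"
        using vertex[of x] x strict_mono_eq[OF mono, of r "x \<bullet> v"] by (simp add: X_def)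
      moreover have "isCont \<phi> r" using cont by (simp add: continuous_on_eq_continuous_at)
      ultimately have "isCont (\<lambda>r. (r - x \<bullet> v) / (\<phi> r - x \<bullet> w)) r"
        by (intro continuous_intros) auto
      moreover have "\<forall>\<^sub>F s in nhds r. c x s = (s - x \<bullet> v) / (\<phi> s - x \<bullet> w)"
        using t1_space_nhds[OF False] by (rule eventually_mono) (simp add: c_def)
      ultimately show ?thesis by (simp add: isCont_cong)
    qed
    then show ?thesis by (simp add: continuous_on_eq_continuous_at)
  qed
  have coords: "\<And>x. 0 \<le> ?u y x" "sum (?u y) X = 1" "(\<Sum>x\<in>X. ?u y x *\<^sub>R x) = y"
    if "y \<in> \<Union>K" for y
    using barycentric_coords[OF K that] by (simp_all add: barycentric_def barycentric_point_def X_def)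

  text \<open>Rescaling the coordinates by positive weights keeps their support, hence the simplex.\<close>

  define scale_sum where "scale_sum a y = (\<Sum>x\<in>X. ?u y x * a x)" for a :: "'a \<Rightarrow> real" and y
  \<comment> \<open>Off \<open>X\<close> the coordinates vanish. The weight 1 there keeps all
    weights nonzero, so they can be cancelled at every \<open>x\<close>.\<close>
  define rescale where "rescale a y x = ?u y x * (if x \<in> X then a x else 1) / scale_sum a y"
    for a :: "'a \<Rightarrow> real" and y x
  have scale_sum_pos: "0 < scale_sum a y" if y: "y \<in> \<Union>K" and a: "\<And>x. x \<in> X \<Longrightarrow> 0 < a x" for a y
  proof -
    have "\<exists>x\<in>X. ?u y x \<noteq> 0" using coords(2)[OF y] by (metis sum.neutral zero_neq_one)
    then obtain z where z: "z \<in> X" "?u y z \<noteq> 0" by blast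
    have "?u y z > 0" using z coords(1)[OF y, of z] by simp
    then show ?thesis unfolding scale_sum_def
      using fin z(1) coords(1)[OF y] a by (intro sum_pos2[of X z]) (auto simp: less_imp_le)
  qed
  have rescale: "barycentric K (rescale a y)"
    if y: "y \<in> \<Union>K" and a: "\<And>x. x \<in> X \<Longrightarrow> 0 < a x" for a y
  proof -
    note pos = scale_sum_pos[of y a, OF y a]
    obtain S where S: "S \<in> K" "\<And>x. ?u y x \<noteq> 0 \<Longrightarrow> x \<in> vertex_set K \<inter> S"
      using barycentric_coords(1)[OF K y] by (auto simp: barycentric_def)
    have "sum (rescale a y) X = (\<Sum>x\<in>X. ?u y x * a x / scale_sum a y)"
      by (simp add: rescale_def)
    also have "\<dots> = scale_sum a y / scale_sum a y"
      by (simp only: sum_divide_distrib[symmetric] scale_sum_def)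
    finally have "sum (rescale a y) X = 1" using pos by simp
    moreover have "0 \<le> rescale a y x" for x
      using coords(1)[OF y, of x] pos a[of x] by (auto simp: rescale_def less_imp_le)
    moreover have "\<forall>x. rescale a y x \<noteq> 0 \<longrightarrow> x \<in> vertex_set K \<inter> S"
      using S(2) by (auto simp: rescale_def)
    ultimately show ?thesis using S(1) unfolding barycentric_def X_def by blast
  qed
  have rescale_height: "(\<Sum>x\<in>X. rescale a y x * h x) = (\<Sum>x\<in>X. ?u y x * (a x * h x)) / scale_sum a y"
    for a h y
    by (simp add: rescale_def sum_divide_distrib mult.assoc cong: sum.cong)
  \<comment> \<open>As the coordinates sum to 1, the constant \<open>s\<close> can be moved inside
    the weighted sum.\<close>
  have level: "barycentric_point K u \<bullet> d - s = (\<Sum>x\<in>X. u x * (x \<bullet> d - s))"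
    if "sum u X = 1" for u d s
    using that
    by (simp add: barycentric_point_def X_def inner_sum_left right_diff_distrib sum_subtractf
        sum_distrib_right[symmetric])

  define f where "f y = barycentric_point K (rescale (\<lambda>x. c x (y \<bullet> v)) y)" for y
  have f_coords: "?u (f y) = rescale (\<lambda>x. c x (y \<bullet> v)) y" if "y \<in> \<Union>K" for y
    using rescale[OF that, of "\<lambda>x. c x (y \<bullet> v)"] c_pos unfolding f_def
    by (intro barycentric_coords_eq[OF K]) auto
  have f_in: "f y \<in> \<Union>K" if "y \<in> \<Union>K" for y
    unfolding f_def using rescale[OF that, of "\<lambda>x. c x (y \<bullet> v)"] c_pos
    by (intro barycentric_point_in_polyhedron[OF K]) auto
  have f_height: "f y \<bullet> w = \<phi> (y \<bullet> v)" if y: "y \<in> \<Union>K" for y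
  proof -
    let ?a = "\<lambda>x. c x (y \<bullet> v)"
    have "sum (rescale ?a y) X = 1"
      using rescale[OF y, of ?a] c_pos by (simp add: barycentric_def X_def)
    then have "f y \<bullet> w - \<phi> (y \<bullet> v) = (\<Sum>x\<in>X. rescale ?a y x * (x \<bullet> w - \<phi> (y \<bullet> v)))"
      unfolding f_def by (rule level)
    also have "\<dots> = (\<Sum>x\<in>X. ?u y x * (?a x * (x \<bullet> w - \<phi> (y \<bullet> v)))) / scale_sum ?a y"
      by (rule rescale_height)
    \<comment> \<open>The weights turn \<open>w\<close>-heights relative to
      \<open>\<phi> (y \<bullet> v)\<close> into \<open>v\<close>-heights relative to
      \<open>y \<bullet> v\<close>, whose weighted sum is zero.\<close>
    also have "(\<Sum>x\<in>X. ?u y x * (?a x * (x \<bullet> w - \<phi> (y \<bullet> v)))) = (\<Sum>x\<in>X. ?u y x * (x \<bullet> v - y \<bullet> v))"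
      by (intro sum.cong refl) (simp only: c_eq)
    also have "\<dots> = y \<bullet> v - y \<bullet> v"
      using level[OF coords(2)[OF y], of v "y \<bullet> v"] barycentric_coords(2)[OF K y] by simp
    finally show ?thesis by simp
  qed
  \<comment> \<open>Equal images force equal \<open>v\<close>-heights, hence equal weights. The
    coordinates of the two points are then proportional, and their sums of 1 make the factor
    1.\<close>
  have inj: "inj_on f (\<Union>K)"
  proof (rule inj_onI)
    fix y z assume yz: "y \<in> \<Union>K" "z \<in> \<Union>K" "f y = f z"
    define r where "r = y \<bullet> v"
    have "\<phi> (y \<bullet> v) = \<phi> (z \<bullet> v)" using yz f_height by metis
    then have r: "y \<bullet> v = r" "z \<bullet> v = r" using strict_mono_eq[OF mono] by (simp_all add: r_def)
    define N M where "N = scale_sum (\<lambda>x. c x r) y" and "M = scale_sum (\<lambda>x. c x r) z"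
    have NM: "N > 0" "M > 0" using scale_sum_pos yz c_pos by (simp_all add: N_def M_def)
    have eq: "?u y x * M = ?u z x * N" for x
    proof -
      have "rescale (\<lambda>x. c x r) y x = rescale (\<lambda>x. c x r) z x"
        using f_coords[OF yz(1)] f_coords[OF yz(2)] yz(3) r by simp
      then show ?thesis
        using NM c_pos[of x r] by (simp add: rescale_def N_def[symmetric] M_def[symmetric] field_simps split: if_splits)
    qed
    have "sum (?u y) X * M = sum (?u z) X * N"
      unfolding sum_distrib_right using eq by simp
    then have "M = N" using coords(2) yz by simp
    then have "?u y = ?u z" using eq NM by (intro ext) (metis less_irrefl mult_right_cancel)
    then show "y = z" using barycentric_coords(2)[OF K] yz by metis
  qed
  have "\<exists>y\<in>\<Union>K. f y = z" if z: "z \<in> \<Union>K" for z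
  proof -
    \<comment> \<open>A preimage of \<open>z\<close> must have \<open>v\<close>-height
      \<open>r\<close>, so it is found by rescaling with the inverse weights
      \<open>1 / c x r\<close>.\<close>
    obtain r where r: "\<phi> r = z \<bullet> w" using surj by (metis surjD)
    define a where "a x = 1 / c x r" for x
    have a: "0 < a x" if "x \<in> X" for x using c_pos that by (simp add: a_def)
    define y where "y = barycentric_point K (rescale a z)"
    have u: "barycentric K (rescale a z)" using rescale[OF z] a by blast
    have y: "y \<in> \<Union>K" unfolding y_def by (rule barycentric_point_in_polyhedron[OF K u])
    have uy: "?u y = rescale a z" by (rule barycentric_coords_eq[OF K u]) (simp add: y_def)
    have M: "0 < scale_sum a z" using scale_sum_pos[OF z] a by blast
    have "y \<bullet> v - r = (\<Sum>x\<in>X. rescale a z x * (x \<bullet> v - r))"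
      unfolding y_def using u by (intro level) (simp add: barycentric_def X_def)
    also have "\<dots> = (\<Sum>x\<in>X. ?u z x * (a x * (x \<bullet> v - r))) / scale_sum a z"
      by (rule rescale_height)
    also have "(\<Sum>x\<in>X. ?u z x * (a x * (x \<bullet> v - r))) = (\<Sum>x\<in>X. ?u z x * (x \<bullet> w - \<phi> r))"
    proof (intro sum.cong refl)
      fix x assume x: "x \<in> X"
      have "a x * (x \<bullet> v - r) = a x * (c x r * (x \<bullet> w - \<phi> r))"
        by (simp only: c_eq[OF x])
      also have "\<dots> = x \<bullet> w - \<phi> r" using c_pos[OF x, of r] by (simp add: a_def)
      finally show "?u z x * (a x * (x \<bullet> v - r)) = ?u z x * (x \<bullet> w - \<phi> r)" by simp
    qed
    also have "\<dots> = 0"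
      using level[OF coords(2)[OF z], of w "\<phi> r"] barycentric_coords(2)[OF K z] r by simp
    finally have yr: "y \<bullet> v = r" by simp
    \<comment> \<open>The two normalising constants are reciprocal, so rescaling back returns
      exactly the coordinates of \<open>z\<close>.\<close>
    have "scale_sum (\<lambda>x. c x r) y = (\<Sum>x\<in>X. ?u z x / scale_sum a z)"
      unfolding scale_sum_def[of "\<lambda>x. c x r"] uy
    proof (intro sum.cong refl)
      fix x assume x: "x \<in> X"
      show "rescale a z x * c x r = ?u z x / scale_sum a z"
        using x c_pos[OF x, of r] by (simp add: rescale_def a_def)
    qed
    also have "\<dots> = 1 / scale_sum a z"
      using coords(2)[OF z] by (simp add: sum_divide_distrib[symmetric])
    finally have N: "scale_sum (\<lambda>x. c x r) y = 1 / scale_sum a z" .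
    have "rescale (\<lambda>x. c x r) y x = ?u z x" for x
      using M c_pos[of x r, THEN less_imp_neq] by (simp add: rescale_def[of "\<lambda>x. c x r"] N uy) (simp add: rescale_def a_def)
    then have "f y = barycentric_point K (?u z)" unfolding f_def yr by presburger
    then show ?thesis using barycentric_coords(2)[OF K z] y by auto
  qed
  then have img: "f ` \<Union>K = \<Union>K" using f_in by blast
  have "continuous_on (\<Union>K) f"
  proof -
    have c_comp: "continuous_on (\<Union>K) (\<lambda>y. c x (y \<bullet> v))" if "x \<in> X" for x
      by (rule continuous_on_compose2[OF c_cont[OF that]]) (auto intro!: continuous_intros)
    have "continuous_on (\<Union>K) (\<lambda>y. scale_sum (\<lambda>x. c x (y \<bullet> v)) y)"
      unfolding scale_sum_def
      by (intro continuous_on_sum continuous_on_mult continuous_on_barycentric_coords[OF K] c_comp)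
    moreover have "scale_sum (\<lambda>x. c x (y \<bullet> v)) y \<noteq> 0" if "y \<in> \<Union>K" for y
      using scale_sum_pos[OF that, of "\<lambda>x. c x (y \<bullet> v)"] c_pos by force
    ultimately have "continuous_on (\<Union>K)
        (\<lambda>y. \<Sum>x\<in>X. (?u y x * c x (y \<bullet> v) / scale_sum (\<lambda>x. c x (y \<bullet> v)) y) *\<^sub>R x)"
      by (intro continuous_on_sum continuous_on_scaleR continuous_on_divide continuous_on_mult
          continuous_on_const continuous_on_barycentric_coords[OF K] c_comp) auto
    then show ?thesis
      unfolding f_def barycentric_point_def rescale_def X_def[symmetric] by (simp cong: sum.cong)
  qed
  \<comment> \<open>A continuous bijection of the compact polyhedron onto itself has a continuous
    inverse.\<close>
  then obtain g where "homeomorphism (\<Union>K) (\<Union>K) f g"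
    using homeomorphism_compact[OF compact_polyhedron[OF K] _ img inj] by blast
  then show ?thesis using that f_height by blast
qed

text \<open>The same homeomorphism maps both sublevel sets onto their counterparts, because
  \<open>\<phi>\<close> preserves and reflects the order of heights.\<close>

lemma inclusion_rank_height_change:
  fixes K :: "'a::euclidean_space set set" and F :: "'f::field itself"
  assumes K: "simplicial_complex K"
    and mono: "strict_mono \<phi>" and surj: "surj \<phi>" and cont: "continuous_on UNIV \<phi>"
    and vertex: "\<And>x. x \<in> vertex_set K \<Longrightarrow> \<phi> (x \<bullet> v) = x \<bullet> w"
    and deriv: "\<And>x. x \<in> vertex_set K \<Longrightarrow> (\<phi> has_real_derivative 1) (at (x \<bullet> v))"
    and st: "s \<le> t"
  shows "inclusion_rank F k (sublevel K v s) (sublevel K v t) =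
         inclusion_rank F k (sublevel K w (\<phi> s)) (sublevel K w (\<phi> t))"
proof -
  obtain f g where fg: "homeomorphism (\<Union>K) (\<Union>K) f g"
    and height: "\<And>y. y \<in> \<Union>K \<Longrightarrow> f y \<bullet> w = \<phi> (y \<bullet> v)"
    using height_change_homeomorphism[OF K mono surj cont vertex deriv] by blast
  have img: "f ` sublevel K v r = sublevel K w (\<phi> r)" for r
  proof -
    have f: "f y \<in> sublevel K w (\<phi> r) \<longleftrightarrow> y \<in> sublevel K v r" if "y \<in> \<Union>K" for y
    proof -
      have "f y \<in> \<Union>K" using that homeomorphism_image1[OF fg] by blast
      then show ?thesis
        using height[OF that] that strict_mono_less_eq[OF mono] by (simp add: sublevel_def)
    qed
    have sub: "sublevel K d r \<subseteq> \<Union>K" for d r by (auto simp: sublevel_def)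
    show ?thesis
    proof
      show "f ` sublevel K v r \<subseteq> sublevel K w (\<phi> r)" using f sub by blast
      show "sublevel K w (\<phi> r) \<subseteq> f ` sublevel K v r"
      proof
        fix z assume z: "z \<in> sublevel K w (\<phi> r)"
        then have "z \<in> f ` \<Union>K" using sub homeomorphism_image1[OF fg] by blast
        then obtain y where "y \<in> \<Union>K" "z = f y" by blast
        then show "z \<in> f ` sublevel K v r" using f z by blast
      qed
    qed
  qed
  have sub: "sublevel K d r \<subseteq> \<Union>K" for d r by (auto simp: sublevel_def)
  have "homeomorphism (sublevel K v t) (sublevel K w (\<phi> t)) f g"
    by (rule homeomorphism_of_subsets[OF fg sub sub img])
  moreover have "sublevel K v s \<subseteq> sublevel K v t" using st by (auto simp: sublevel_def)
  ultimately show ?thesis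
    using inclusion_rank_homeomorphism img by metis
qed

section \<open>Reparametrising persistence diagrams\<close>

definition ereal_map :: "(real \<Rightarrow> real) \<Rightarrow> ereal \<Rightarrow> ereal" where
  "ereal_map \<phi> e = (if \<bar>e\<bar> = \<infinity> then e else ereal (\<phi> (real_of_ereal e)))"

lemma ereal_map_simps [simp]:
  "ereal_map \<phi> (ereal r) = ereal (\<phi> r)" "ereal_map \<phi> \<infinity> = \<infinity>" "ereal_map \<phi> (-\<infinity>) = -\<infinity>"
  by (simp_all add: ereal_map_def)

lemma ereal_map_less_iff:
  assumes "strict_mono \<phi>"
  shows "ereal_map \<phi> a < ereal_map \<phi> b \<longleftrightarrow> a < b"
  by (cases a; cases b) (simp_all add: strict_mono_less[OF assms])

lemma bij_ereal_map:
  assumes "strict_mono \<phi>" "surj \<phi>"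
  shows "bij (ereal_map \<phi>)"
proof (rule bijI)
  show "inj (ereal_map \<phi>)"
    by (rule injI) (metis assms(1) ereal_map_less_iff less_irrefl linorder_less_linear)
  have "\<exists>a. ereal_map \<phi> a = b" for b
  proof (cases b)
    case (real r)
    then show ?thesis using surjD[OF assms(2), of r] by (metis ereal_map_simps(1))
  qed (metis ereal_map_simps(2), metis ereal_map_simps(3))
  then show "surj (ereal_map \<phi>)" by (metis surjI)
qed

lemma bij_image_mset:
  assumes "bij f"
  shows "bij (image_mset f)"
proof (rule bijI)
  show "inj (image_mset f)" using assms by (simp add: bij_is_inj multiset.inj_map)
  show "surj (image_mset f)"
    by (rule surjI[of _ "image_mset (inv_into UNIV f)"])
      (simp add: multiset.map_comp o_def surj_f_inv_f[OF bij_is_surj[OF assms]])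
qed

text \<open>By surjectivity the thresholds in direction \<open>w\<close> may be written as
  \<open>\<phi> s\<close> and \<open>\<phi> t\<close>. A mapped point is counted there exactly when
  the original point is counted at \<open>s\<close> and \<open>t\<close>.\<close>

lemma is_persistence_diagram_reparametrize:
  assumes mono: "strict_mono \<phi>" and surj: "surj \<phi>"
    and rank: "\<And>s t. s \<le> t \<Longrightarrow>
        inclusion_rank F k (sublevel K v s) (sublevel K v t) =
        inclusion_rank F k (sublevel K w (\<phi> s)) (sublevel K w (\<phi> t))"
  shows "is_persistence_diagram F k K w (image_mset (map_prod (ereal_map \<phi>) (ereal_map \<phi>)) D) \<longleftrightarrow>
         is_persistence_diagram F k K v D"
proof -
  let ?\<psi> = "ereal_map \<phi>"
  have le: "?\<psi> a \<le> ereal (\<phi> s) \<longleftrightarrow> a \<le> ereal s" and less: "ereal (\<phi> s) < ?\<psi> a \<longleftrightarrow> ereal s < a" for a s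
    using ereal_map_less_iff[OF mono, of "ereal s" a] by (auto simp: not_less[symmetric])
  have surj_all: "(\<forall>s. P s) \<longleftrightarrow> (\<forall>s. P (\<phi> s))" for P
    using surj by (metis surjD)
  show ?thesis
    unfolding is_persistence_diagram_def
    by (subst (1 2) surj_all)
      (auto simp: ereal_map_less_iff[OF mono] strict_mono_less_eq[OF mono] rank
        filter_mset_image_mset le less case_prod_unfold)
qed

text \<open>The map on multisets is a bijection between diagrams for \<open>v\<close> and for
  \<open>w\<close>, so unique existence transfers both ways and \<open>None\<close> corresponds to
  \<open>None\<close>.\<close>

lemma PH_reparametrize:
  assumes "strict_mono \<phi>" "surj \<phi>"
    and "\<And>s t. s \<le> t \<Longrightarrow>
        inclusion_rank F k (sublevel K v s) (sublevel K v t) =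
        inclusion_rank F k (sublevel K w (\<phi> s)) (sublevel K w (\<phi> t))"
  shows "PH F k K w = map_option (image_mset (map_prod (ereal_map \<phi>) (ereal_map \<phi>))) (PH F k K v)"
proof -
  let ?G = "image_mset (map_prod (ereal_map \<phi>) (ereal_map \<phi>))"
  let ?P = "is_persistence_diagram F k K v" and ?Q = "is_persistence_diagram F k K w"
  have iff: "?Q (?G D) \<longleftrightarrow> ?P D" for D
    by (rule is_persistence_diagram_reparametrize[OF assms])
  have G: "bij ?G"
    using bij_ereal_map[OF assms(1,2)] by (intro bij_image_mset) (simp add: bij_def prod.inj_map map_prod_surj)
  show ?thesis
  proof (cases "\<exists>!D. ?P D")
    case True
    then obtain D where D: "?P D" "\<And>D'. ?P D' \<Longrightarrow> D' = D" by blast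
    have uniq: "E = ?G D" if "?Q E" for E
    proof -
      obtain D' where D': "E = ?G D'" using G by (metis bij_pointE)
      then show ?thesis using that iff D(2) by blast
    qed
    have "(THE D. ?P D) = D" using D by (rule the_equality)
    moreover have "(THE E. ?Q E) = ?G D" using iff D(1) uniq by (intro the_equality) blast+
    moreover have "\<exists>!E. ?Q E" using iff D(1) uniq by blast
    ultimately show ?thesis using True by (simp add: PH_def)
  next
    case False
    have "\<not> (\<exists>!E. ?Q E)"
    proof
      assume "\<exists>!E. ?Q E"
      then obtain E where E: "?Q E" "\<And>E'. ?Q E' \<Longrightarrow> E' = E" by blast
      obtain D where "E = ?G D" using G by (metis bij_pointE)
      then have "?P D" "\<And>D'. ?P D' \<Longrightarrow> D' = D"
        using E iff bij_is_inj[OF G, THEN injD] by blast+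
      then show False using False by blast
    qed
    then show ?thesis using False by (simp add: PH_def)
  qed
qed

section \<open>Order of the vertex heights on a component, and the conclusion\<close>

lemma connected_component_Sigma_set_order:
  fixes X :: "'a::euclidean_space set"
  assumes "connected_component (Sigma_set X) v w" and x: "x \<in> X" and y: "y \<in> X"
  shows "x \<bullet> v < y \<bullet> v \<longleftrightarrow> x \<bullet> w < y \<bullet> w"
proof (cases "x = y")
  case False
  obtain T where T: "connected T" "T \<subseteq> Sigma_set X" "v \<in> T" "w \<in> T"
    using assms(1) by (auto simp: connected_component_def)
  have nz: "(y - x) \<bullet> u \<noteq> 0" if "u \<in> T" for u
    using T(2) that x y False by (auto simp: Sigma_set_def W_set_def inner_diff_left)
  have "connected ((\<lambda>u. (y - x) \<bullet> u) ` T)"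
    by (intro connected_continuous_image T continuous_intros)
  then have iv: "a \<in> (\<lambda>u. (y - x) \<bullet> u) ` T"
    if "b \<in> (\<lambda>u. (y - x) \<bullet> u) ` T" "c \<in> (\<lambda>u. (y - x) \<bullet> u) ` T" "b \<le> a" "a \<le> c" for a b c
    using that connectedD_interval by blast
  \<comment> \<open>The functional \<open>(y - x) \<bullet> u\<close> has no zero on
    \<open>T\<close>, because its zero hyperplane lies in \<open>W_set X\<close>; on a connected set
    its sign is therefore constant.\<close>
  have "0 < (y - x) \<bullet> v \<longleftrightarrow> 0 < (y - x) \<bullet> w"
  proof (rule ccontr)
    assume "\<not> ?thesis"
    then have "0 \<in> (\<lambda>u. (y - x) \<bullet> u) ` T"
      using iv[of "(y - x) \<bullet> v" "(y - x) \<bullet> w" 0] iv[of "(y - x) \<bullet> w" "(y - x) \<bullet> v" 0] T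
      by (smt (verit) imageI)
    then show False using nz by force
  qed
  then show ?thesis by (simp add: inner_diff_left)
qed simp

theorem proposition5p21:
  fixes X :: "(real ^ 'n) set" and v w :: "real ^ 'n" and F :: "'f::field itself"
  assumes "finite X"
    and "connected_component (Sigma_set X) v w"
  shows "(\<forall>K K'. simplicial_complex K \<and> vertex_set K = X \<and>
                  simplicial_complex K' \<and> vertex_set K' = X \<longrightarrow>
                  ECT F K v = ECT F K' v \<longrightarrow> ECT F K w = ECT F K' w) \<and>
         (\<forall>k K K'. simplicial_complex K \<and> vertex_set K = X \<and>
                    simplicial_complex K' \<and> vertex_set K' = X \<longrightarrow>
                    PH F k K v = PH F k K' v \<longrightarrow> PH F k K w = PH F k K' w)"
proof -
  note order = connected_component_Sigma_set_order[OF assms(2)]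
  have "v \<in> Sigma_set X" using connected_component_in[OF assms(2)] by blast
  then have inj: "inj_on (\<lambda>x. x \<bullet> v) X"
    by (auto simp: Sigma_set_def W_set_def inj_on_def)
  \<comment> \<open>Well defined on vertex heights, since distinct vertices have distinct heights in
    direction \<open>v\<close>.\<close>
  define b where "b r = inv_into X (\<lambda>x. x \<bullet> v) r \<bullet> w" for r
  have b: "b (x \<bullet> v) = x \<bullet> w" if "x \<in> X" for x
    using that inj by (simp add: b_def inv_into_f_f[OF inj])
  have "strict_mono_on ((\<lambda>x. x \<bullet> v) ` X) b"
    using order by (auto simp: strict_mono_on_def b)
  \<comment> \<open>\<open>\<phi>\<close> is chosen from \<open>X\<close>, \<open>v\<close> and
    \<open>w\<close> before any complex is considered, so one reparametrisation serves both
    \<open>K\<close> and \<open>K'\<close>.\<close>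
  with assms(1) obtain \<phi> where mono: "strict_mono \<phi>" and surj: "surj \<phi>" and cont: "continuous_on UNIV \<phi>"
    and vertex: "\<And>r. r \<in> (\<lambda>x. x \<bullet> v) ` X \<Longrightarrow> \<phi> r = b r"
    and deriv: "\<And>r. r \<in> (\<lambda>x. x \<bullet> v) ` X \<Longrightarrow> (\<phi> has_real_derivative 1) (at r)"
    using strict_mono_on_interpolation[of "(\<lambda>x. x \<bullet> v) ` X" b] by blast
  have rank: "inclusion_rank F k (sublevel K v s) (sublevel K v t) =
        inclusion_rank F k (sublevel K w (\<phi> s)) (sublevel K w (\<phi> t))"
    if "simplicial_complex K" "vertex_set K = X" "s \<le> t" for K k s t
    using that vertex deriv b by (intro inclusion_rank_height_change[OF that(1) mono surj cont]) auto
  have ECT: "ECT F K w (\<phi> s) = ECT F K v s" if "simplicial_complex K" "vertex_set K = X" for K s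
    using rank[OF that, of s s]
    by (simp add: ECT_def euler_characteristic_def betti_eq_inclusion_rank)
  have "ECT F K w = ECT F K' w"
    if "simplicial_complex K" "vertex_set K = X" "simplicial_complex K'" "vertex_set K' = X"
      "ECT F K v = ECT F K' v" for K K'
  proof
    fix t
    obtain s where "t = \<phi> s" using surj by (metis surjD)
    then show "ECT F K w t = ECT F K' w t" using ECT that by simp
  qed
  moreover have "PH F k K w = PH F k K' w"
    if "simplicial_complex K" "vertex_set K = X" "simplicial_complex K'" "vertex_set K' = X"
      "PH F k K v = PH F k K' v" for K K' k
    \<comment> \<open>Both diagrams for \<open>w\<close> are images of the common diagram for
      \<open>v\<close> under the same map.\<close>
    using PH_reparametrize[OF mono surj rank[OF that(1,2)]]
      PH_reparametrize[OF mono surj rank[OF that(3,4)]] that(5) by simp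
  ultimately show ?thesis by blast
qed

end
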